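(* Let $0 < \alpha < 1$ be such that $\frac{1 + \sqrt{1 - 4\alpha^2}}{2 \alpha^2} - 1$ is a prime power and assume $\alpha \rightarrow 0$. Then for all $r\in\mathbb{N}$ with $\frac{1 + \sqrt{1 - 4\alpha^2}}{2 \alpha^2} \leq r < \frac{1 - o(1)}{\alpha^3}$, we have \[ N^{\mathbb{C}}_\alpha(r) = \frac{1-o(1)}{\alpha^4}. \] That is, there exist functions $\delta(\alpha), \varepsilon(\alpha)$ tending to $0$ as $\alpha\to 0$ such that for every such $\alpha$ and every $r \in \mathbb{N}$ with $\frac{1 + \sqrt{1 - 4\alpha^2}}{2 \alpha^2} \leq r < \frac{1-\delta(\alpha)}{\alpha^3}$, one has $\left|\alpha^4 N^{\mathbb{C}}_\alpha(r) - 1\right| \leq \varepsilon(\alpha)$.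
   Context: $\mathbb{N}$ is the set of positive integers. Complex lines (1-dimensional subspaces) $l_1,\dots,l_n$ of $\mathbb{C}^r$ are equiangular with common Hermitian angle $\arccos(\alpha)$ if, choosing a unit vector $v_i \in l_i$, one has $|\langle v_i, v_j\rangle| = \alpha$ for all $i \neq j$ (standard Hermitian inner product). $N^{\mathbb{C}}_\alpha(r)$ denotes the maximum number of complex equiangular lines in $\mathbb{C}^r$ with common Hermitian angle $\arccos(\alpha)$. *)

theory Defs
  imports Complex_Main "Jordan_Normal_Form.VS_Connect" "HOL-Number_Theory.Prime_Powers"
begin

definition complex_line :: "nat \<Rightarrow> complex vec set \<Rightarrow> bool" where
  "complex_line r l \<longleftrightarrow>
     VectorSpace.subspace class_ring l (module_vec TYPE(complex) r) \<and>
     vectorspace.dim class_ring ((module_vec TYPE(complex) r)\<lparr>carrier := l\<rparr>) = 1"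

(* u \<bullet>c v is the sum of u_k * cnj (v_k). Unit vectors in a line are unique up to a phase,
   so the choice of the v i is immaterial. Two equal lines would give modulus 1, so for
   \<alpha> < 1 the lines l 0, ..., l (n - 1) are pairwise distinct. *)
definition complex_equiangular ::
    "nat \<Rightarrow> real \<Rightarrow> nat \<Rightarrow> (nat \<Rightarrow> complex vec set) \<Rightarrow> bool" where
  "complex_equiangular r \<alpha> n l \<longleftrightarrow>
     (\<forall>i<n. complex_line r (l i)) \<and>
     (\<exists>v. (\<forall>i<n. v i \<in> l i \<and> v i \<bullet>c v i = 1) \<and>
          (\<forall>i<n. \<forall>j<n. i \<noteq> j \<longrightarrow> cmod (v i \<bullet>c v j) = \<alpha>))"

(* For 0 \<le> \<alpha> < 1 the set below is finite (it is bounded by r^2) and contains 0,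
   so Max is a genuine maximum. *)
definition max_complex_equiangular :: "real \<Rightarrow> nat \<Rightarrow> nat" where
  "max_complex_equiangular \<alpha> r = Max {n. \<exists>l. complex_equiangular r \<alpha> n l}"

end

theory Submission
  imports Defs "Jordan_Normal_Form.Schur_Decomposition" "HOL-Number_Theory.Cong"
begin

text \<open>
  Write \<open>D = q + 1\<close> for the left end of the range of \<open>r\<close>; then \<open>\<alpha>\<^sup>2 = q / (q + 1)\<^sup>2\<close>.

  Lower bound: a Singer difference set of size \<open>q + 1\<close> modulo \<open>N = q\<^sup>2 + q + 1\<close> gives \<open>N\<close> equiangular
  lines in dimension \<open>q + 1\<close>, spanned by the restrictions of the \<open>N\<close> characters of \<open>\<int>/N\<close> to the
  difference set, and \<open>\<alpha>\<^sup>4 N \<longlonglongrightarrow> 1\<close>. The finite fields behind the difference set are realised inside the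
  complex numbers: for \<open>z = exp (2\<pi>\<i>/(q\<^sup>3 - 1))\<close> and a prime ideal \<open>P\<close> of \<open>\<int>[z]\<close> containing the
  characteristic, \<open>\<int>[z]/P\<close> is the field with \<open>q\<^sup>3\<close> elements and \<open>z\<close> generates its multiplicative
  group. The difference set consists of the discrete logarithms modulo \<open>N\<close> of \<open>1\<close> and of the \<open>z + a\<close>
  with \<open>a\<close> in the subfield of order \<open>q\<close>.

  Upper bound: with \<open>P\<^sub>k = v\<^sub>k v\<^sub>k\<^sup>*\<close>, the Gram matrix of the \<open>P\<^sub>k\<close> in the Frobenius inner product is
  \<open>(1 - \<alpha>\<^sup>2) I + \<alpha>\<^sup>2 J\<close>, so that projecting a matrix \<open>X\<close> onto their span bounds
  \<open>\<Sum>\<^sub>k |\<langle>X, P\<^sub>k\<rangle>|\<^sup>2\<close> explicitly in terms of \<open>|X|\<close> and \<open>\<Sum>\<^sub>k \<langle>X, P\<^sub>k\<rangle>\<close>. Taking \<open>X = v\<^sub>i v\<^sub>j\<^sup>*\<close> bounds the fourth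
  moment of the spectrum of \<open>S = \<Sum>\<^sub>k P\<^sub>k\<close> from below, which forces an eigenvalue \<open>\<mu>\<close> of order \<open>n \<alpha>\<close> as
  soon as \<open>n \<alpha>\<^sup>4 \<ge> 1 + e\<close>. Taking \<open>X = u v\<^sub>j\<^sup>*\<close> for an eigenvector \<open>u\<close> and summing over \<open>j\<close> shows that
  the remaining eigenvalues satisfy \<open>\<Sum> \<lambda>\<^sup>2 \<le> n b / (\<alpha>\<^sup>2 \<mu>)\<close> with \<open>b \<approx> n \<alpha>\<^sup>2\<close>, while \<open>\<Sum> \<lambda> = n - \<mu>\<close>. By
  Cauchy--Schwarz there are at least about \<open>n \<alpha>\<close> of them, that is \<open>r \<ge> (1 + e - o(1)) / \<alpha>\<^sup>3\<close>.
\<close>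

section \<open>Prime ideals in cyclotomic rings\<close>

text \<open>The residue ring of \<open>A\<close> modulo \<open>P\<close> is never built as a type:
  \<open>A\<close> is a set inside an ambient ring, and the arithmetic of the quotient, an integral
  domain, is expressed by the congruence \<open>\<approx>\<close>.\<close>

locale subring_prime_ideal =
  fixes A P :: "'a::comm_ring_1 set"
  assumes one_A: "1 \<in> A"
    and diff_A: "x \<in> A \<Longrightarrow> y \<in> A \<Longrightarrow> x - y \<in> A"
    and mult_A: "x \<in> A \<Longrightarrow> y \<in> A \<Longrightarrow> x * y \<in> A"
    and P_subset: "P \<subseteq> A"
    and zero_P: "0 \<in> P"
    and diff_P: "x \<in> P \<Longrightarrow> y \<in> P \<Longrightarrow> x - y \<in> P"
    and mult_P: "a \<in> A \<Longrightarrow> x \<in> P \<Longrightarrow> a * x \<in> P"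
    and one_notin_P: "1 \<notin> P"
    and prime_P: "x \<in> A \<Longrightarrow> y \<in> A \<Longrightarrow> x * y \<in> P \<Longrightarrow> x \<in> P \<or> y \<in> P"
begin

definition eqv :: "'a \<Rightarrow> 'a \<Rightarrow> bool" (infix \<open>\<approx>\<close> 50) where
  "x \<approx> y \<longleftrightarrow> x - y \<in> P"

lemma zero_A: "0 \<in> A"
  using diff_A[OF one_A one_A] by simp

lemma uminus_A: "x \<in> A \<Longrightarrow> - x \<in> A"
  using diff_A[OF zero_A] by simp

lemma add_A: "x \<in> A \<Longrightarrow> y \<in> A \<Longrightarrow> x + y \<in> A"
  using diff_A[of x "- y"] uminus_A by simp

lemma power_A: "x \<in> A \<Longrightarrow> x ^ n \<in> A"
  by (induction n) (auto simp: one_A mult_A)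

lemma of_nat_A: "of_nat n \<in> A"
  by (induction n) (auto simp: zero_A one_A add_A)

lemma prod_A: "(\<And>i. i \<in> I \<Longrightarrow> f i \<in> A) \<Longrightarrow> prod f I \<in> A"
  by (induction I rule: infinite_finite_induct) (auto simp: one_A mult_A)

lemma uminus_P: "x \<in> P \<Longrightarrow> - x \<in> P"
  using diff_P[OF zero_P] by simp

lemma add_P: "x \<in> P \<Longrightarrow> y \<in> P \<Longrightarrow> x + y \<in> P"
  using diff_P[of x "- y"] uminus_P by simp

lemma mult_P': "x \<in> P \<Longrightarrow> a \<in> A \<Longrightarrow> x * a \<in> P"
  using mult_P by (simp add: mult.commute)

lemma sum_P: "(\<And>i. i \<in> I \<Longrightarrow> f i \<in> P) \<Longrightarrow> sum f I \<in> P"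
  by (induction I rule: infinite_finite_induct) (auto simp: zero_P add_P)

lemma prime_P_prod:
  "finite I \<Longrightarrow> (\<And>i. i \<in> I \<Longrightarrow> f i \<in> A) \<Longrightarrow> prod f I \<in> P \<Longrightarrow> \<exists>i\<in>I. f i \<in> P"
proof (induction I rule: finite_induct)
  case empty
  then show ?case using one_notin_P by simp
next
  case (insert i I)
  then show ?case using prime_P[of "f i" "prod f I"] by (auto simp: prod_A)
qed

lemma prime_P_power: "x \<in> A \<Longrightarrow> x ^ n \<in> P \<Longrightarrow> x \<in> P"
  by (induction n) (use one_notin_P prime_P power_A in auto)

lemma eqv_refl [simp]: "x \<approx> x"
  by (simp add: eqv_def zero_P)

lemma eqv_sym: "x \<approx> y \<Longrightarrow> y \<approx> x"
  unfolding eqv_def using uminus_P by fastforce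

lemma eqv_trans [trans]: "x \<approx> y \<Longrightarrow> y \<approx> z \<Longrightarrow> x \<approx> z"
  unfolding eqv_def using add_P by fastforce

lemma eqv_add: "x \<approx> y \<Longrightarrow> x' \<approx> y' \<Longrightarrow> x + x' \<approx> y + y'"
  unfolding eqv_def using add_P by (metis add_diff_add)

lemma eqv_uminus: "x \<approx> y \<Longrightarrow> - x \<approx> - y"
  unfolding eqv_def using uminus_P by fastforce

lemma eqv_diff: "x \<approx> y \<Longrightarrow> x' \<approx> y' \<Longrightarrow> x - x' \<approx> y - y'"
  using eqv_add[of x y "- x'" "- y'"] eqv_uminus by simp

text \<open>\<open>P\<close> absorbs multiplication by \<open>A\<close> only, not by the whole
  ambient ring; hence the membership conditions.\<close>

lemma eqv_mult:
  assumes "x \<approx> y" "x' \<approx> y'" "y \<in> A" "x' \<in> A"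
  shows "x * x' \<approx> y * y'"
proof -
  have "x * x' - y * y' = (x - y) * x' + y * (x' - y')"
    by (simp add: algebra_simps)
  then show ?thesis
    using assms unfolding eqv_def by (metis add_P mult_P mult_P')
qed

lemma eqv_power: "x \<approx> y \<Longrightarrow> x \<in> A \<Longrightarrow> y \<in> A \<Longrightarrow> x ^ n \<approx> y ^ n"
  by (induction n) (auto intro!: eqv_mult power_A)

lemma eqv_zero_iff: "x \<approx> 0 \<longleftrightarrow> x \<in> P"
  by (simp add: eqv_def)

lemma eqv_in_P: "x \<approx> y \<Longrightarrow> y \<in> P \<Longrightarrow> x \<in> P"
  using eqv_trans eqv_zero_iff by blast

lemma eqv_mult_left_cancel:
  assumes "c * x \<approx> c * y" "c \<in> A" "c \<notin> P" "x \<in> A" "y \<in> A"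
  shows "x \<approx> y"
proof -
  have "c * (x - y) \<in> P"
    using assms(1) by (simp add: eqv_def algebra_simps)
  then show ?thesis
    using prime_P[of c "x - y"] assms diff_A by (auto simp: eqv_def)
qed

text \<open>Additivity of Frobenius: the inner binomial coefficients are multiples of
  \<open>p\<close>, which lies in \<open>P\<close>.\<close>

lemma eqv_add_power_prime:
  assumes p: "prime p" "of_nat p \<in> P" and x: "x \<in> A" and y: "y \<in> A"
  shows "(x + y) ^ p \<approx> x ^ p + y ^ p"
proof -
  have p0: "p > 0" using p(1) prime_gt_0_nat by blast
  let ?t = "\<lambda>i. of_nat (p choose i) * x ^ i * y ^ (p - i)"
  have "(x + y) ^ p = (\<Sum>i\<le>p. ?t i)"
    by (rule binomial_ring)
  also have "\<dots> = (\<Sum>i\<in>{0, p}. ?t i) + (\<Sum>i\<in>{..p} - {0, p}. ?t i)"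
    by (intro sum.subset_diff[THEN trans]) (auto simp: add.commute)
  also have "(\<Sum>i\<in>{0, p}. ?t i) = x ^ p + y ^ p"
    using p0 by (simp add: add.commute)
  finally have eq: "(x + y) ^ p - (x ^ p + y ^ p) = (\<Sum>i\<in>{..p} - {0, p}. ?t i)"
    by simp
  have "(\<Sum>i\<in>{..p} - {0, p}. ?t i) \<in> P"
  proof (rule sum_P)
    fix i assume "i \<in> {..p} - {0, p}"
    then have "p dvd (p choose i)"
      by (intro dvd_choose_prime) (use p in auto)
    then obtain c where c: "p choose i = p * c" ..
    have "?t i = of_nat p * (of_nat c * x ^ i * y ^ (p - i))"
      by (simp add: c mult.assoc)
    then show "?t i \<in> P"
      using p(2) x y by (metis mult_P' mult_A of_nat_A power_A)
  qed
  then show ?thesis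
    unfolding eqv_def eq .
qed

lemma eqv_add_power_prime_power:
  assumes "prime p" "of_nat p \<in> P" "x \<in> A" "y \<in> A"
  shows "(x + y) ^ (p ^ j) \<approx> x ^ (p ^ j) + y ^ (p ^ j)"
proof (induction j)
  case (Suc j)
  have "(x + y) ^ (p ^ Suc j) = ((x + y) ^ (p ^ j)) ^ p"
    by (simp add: mult.commute flip: power_mult)
  also have "\<dots> \<approx> (x ^ (p ^ j) + y ^ (p ^ j)) ^ p"
    by (intro eqv_power Suc.IH) (auto intro!: add_A power_A assms)
  also have "\<dots> \<approx> (x ^ (p ^ j)) ^ p + (y ^ (p ^ j)) ^ p"
    by (intro eqv_add_power_prime assms power_A)
  also have "\<dots> = x ^ (p ^ Suc j) + y ^ (p ^ Suc j)"
    by (simp add: mult.commute flip: power_mult)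
  finally show ?case .
qed simp

lemma eqv_diff_power_prime_power:
  assumes "prime p" "of_nat p \<in> P" "x \<in> A" "y \<in> A"
  shows "(x - y) ^ (p ^ j) \<approx> x ^ (p ^ j) - y ^ (p ^ j)"
proof -
  \<comment> \<open>Additivity applied to \<open>x = (x - y) + y\<close> avoids a sign that depends
    on the parity of \<open>p\<close>.\<close>
  have "x ^ (p ^ j) \<approx> (x - y) ^ (p ^ j) + y ^ (p ^ j)"
    using eqv_add_power_prime_power[of p "x - y" y j] assms diff_A by simp
  from eqv_diff[OF eqv_sym[OF this] eqv_refl[of "y ^ (p ^ j)"]] show ?thesis
    by simp
qed

end

text \<open>Zorn's lemma gives an ideal maximal among the proper ideals of \<open>A\<close>
  containing \<open>I\<close>; such an ideal is prime.\<close>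

lemma ex_subring_prime_ideal:
  fixes A I :: "'a::comm_ring_1 set"
  assumes A: "1 \<in> A" "\<And>x y. x \<in> A \<Longrightarrow> y \<in> A \<Longrightarrow> x - y \<in> A"
      "\<And>x y. x \<in> A \<Longrightarrow> y \<in> A \<Longrightarrow> x * y \<in> A"
    and I: "I \<subseteq> A" "0 \<in> I" "\<And>x y. x \<in> I \<Longrightarrow> y \<in> I \<Longrightarrow> x - y \<in> I"
      "\<And>a x. a \<in> A \<Longrightarrow> x \<in> I \<Longrightarrow> a * x \<in> I" "1 \<notin> I"
  shows "\<exists>P. I \<subseteq> P \<and> subring_prime_ideal A P"
proof -
  define J where "J = {K. I \<subseteq> K \<and> K \<subseteq> A \<and> (\<forall>x\<in>K. \<forall>y\<in>K. x - y \<in> K) \<and>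
    (\<forall>a\<in>A. \<forall>x\<in>K. a * x \<in> K) \<and> 1 \<notin> K}"
  have JD: "I \<subseteq> K" "K \<subseteq> A" "\<And>x y. x \<in> K \<Longrightarrow> y \<in> K \<Longrightarrow> x - y \<in> K"
    "\<And>a x. a \<in> A \<Longrightarrow> x \<in> K \<Longrightarrow> a * x \<in> K" "1 \<notin> K" if "K \<in> J" for K
    using that by (auto simp: J_def)
  have "\<exists>M\<in>J. \<forall>X\<in>J. M \<subseteq> X \<longrightarrow> X = M"
  proof (rule subset_Zorn_nonempty)
    have "I \<in> J" using I by (simp add: J_def)
    then show "J \<noteq> {}" by auto
    fix C assume C: "C \<noteq> {}" "subset.chain J C"
    then have CJ: "\<And>K. K \<in> C \<Longrightarrow> K \<in> J" and tot: "\<And>K L. K \<in> C \<Longrightarrow> L \<in> C \<Longrightarrow> K \<subseteq> L \<or> L \<subseteq> K"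
      by (auto simp: subset.chain_def)
    have "x - y \<in> \<Union>C" if xy: "x \<in> \<Union>C" "y \<in> \<Union>C" for x y
    proof -
      obtain K L where "K \<in> C" "x \<in> K" "L \<in> C" "y \<in> L" using xy by blast
      then obtain M where "M \<in> C" "x \<in> M" "y \<in> M" using tot[of K L] by blast
      then show ?thesis using JD(3)[OF CJ] by blast
    qed
    moreover have "I \<subseteq> \<Union>C" using C(1) CJ JD(1) by blast
    moreover have "\<Union>C \<subseteq> A" using CJ JD(2) by blast
    moreover have "a * x \<in> \<Union>C" if "a \<in> A" "x \<in> \<Union>C" for a x
      using that CJ JD(4) by (metis UnionE UnionI)
    moreover have "1 \<notin> \<Union>C" using CJ JD(5) by blast
    ultimately show "\<Union>C \<in> J" by (simp add: J_def)
  qed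
  then obtain P where P: "P \<in> J" and max: "\<And>X. X \<in> J \<Longrightarrow> P \<subseteq> X \<Longrightarrow> X = P" by blast
  have P': "I \<subseteq> P" "P \<subseteq> A" "\<And>x y. x \<in> P \<Longrightarrow> y \<in> P \<Longrightarrow> x - y \<in> P"
    "\<And>a x. a \<in> A \<Longrightarrow> x \<in> P \<Longrightarrow> a * x \<in> P" "1 \<notin> P"
    using P unfolding J_def by auto
  have prime: "y \<in> P" if x: "x \<in> A" and y: "y \<in> A" and xy: "x * y \<in> P" and xP: "x \<notin> P" for x y
  proof -
    \<comment> \<open>The ideal generated by \<open>P\<close> and \<open>x\<close>. It is strictly
      larger than \<open>P\<close>, so it contains 1; multiplying \<open>1 = u - a * x\<close> by
      \<open>y\<close> puts \<open>y\<close> into \<open>P\<close>.\<close>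
    define X where "X = {u - a * x | u a. u \<in> P \<and> a \<in> A}"
    have XI: "u - a * x \<in> X" if "u \<in> P" "a \<in> A" for u a
      using that by (auto simp: X_def)
    have XE: "\<exists>u a. v = u - a * x \<and> u \<in> P \<and> a \<in> A" if "v \<in> X" for v
      using that by (simp add: X_def)
    have "0 \<in> A" using A(2)[OF A(1) A(1)] by simp
    have "P \<subseteq> X"
    proof
      fix u assume "u \<in> P"
      then show "u \<in> X" using XI[OF _ \<open>0 \<in> A\<close>, of u] by simp
    qed
    have "x \<in> X"
    proof -
      have "0 - (0 - 1) * x \<in> X"
        using I(2) P'(1) by (intro XI A(2)[OF \<open>0 \<in> A\<close> A(1)]) auto
      then show ?thesis by simp
    qed
    have "X \<notin> J"
      using max[OF _ \<open>P \<subseteq> X\<close>] \<open>x \<in> X\<close> xP by auto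
    moreover have "X \<subseteq> A"
      using P'(2) A(2,3) x by (auto simp: X_def)
    moreover have "v - w \<in> X" if vw: "v \<in> X" "w \<in> X" for v w
    proof -
      obtain u a u' a' where uv: "v = u - a * x" "w = u' - a' * x" "u \<in> P" "u' \<in> P" "a \<in> A" "a' \<in> A"
        using XE[OF vw(1)] XE[OF vw(2)] by auto
      have "v - w = (u - u') - (a - a') * x" unfolding uv(1,2) by (simp add: algebra_simps)
      then show ?thesis using XI[of "u - u'" "a - a'"] uv P'(3) A(2) by metis
    qed
    moreover have "b * v \<in> X" if bv: "b \<in> A" "v \<in> X" for b v
    proof -
      obtain u a where uv: "v = u - a * x" "u \<in> P" "a \<in> A"
        using XE[OF bv(2)] by auto
      have "b * v = b * u - (b * a) * x" unfolding uv(1) by (simp add: algebra_simps)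
      then show ?thesis using XI[of "b * u" "b * a"] uv P'(4) A(3) bv by metis
    qed
    ultimately have "1 \<in> X"
      using order_trans[OF P'(1) \<open>P \<subseteq> X\<close>] unfolding J_def mem_Collect_eq by metis
    from XE[OF this] obtain u a where ua: "1 = u - a * x" "u \<in> P" "a \<in> A" by auto
    have "y = y * (u - a * x)" using ua(1) by simp
    then have "y = y * u - a * (x * y)" by (simp add: algebra_simps)
    moreover have "y * u \<in> P" "a * (x * y) \<in> P" using P'(4) ua(2,3) y xy by auto
    ultimately show ?thesis using P'(3) by metis
  qed
  have "subring_prime_ideal A P"
  proof
    show "0 \<in> P" using I(2) P'(1) by auto
    show "x \<in> P \<or> y \<in> P" if "x \<in> A" "y \<in> A" "x * y \<in> P" for x y
      using prime[OF that] by blast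
  qed (fact A P')+
  then show ?thesis using P'(1) by blast
qed

text \<open>The ring generated by \<open>z\<close> over the integers. With these rules, a property
  holding for 1 and preserved by differences and by multiplication by \<open>z\<close> holds on the
  whole ring.\<close>

inductive_set adjoin_int :: "'a::comm_ring_1 \<Rightarrow> 'a set" for z where
  one: "1 \<in> adjoin_int z"
| gen: "x \<in> adjoin_int z \<Longrightarrow> z * x \<in> adjoin_int z"
| diff: "x \<in> adjoin_int z \<Longrightarrow> y \<in> adjoin_int z \<Longrightarrow> x - y \<in> adjoin_int z"

lemma adjoin_int_mult:
  assumes "x \<in> adjoin_int z" "y \<in> adjoin_int z"
  shows "x * y \<in> adjoin_int z"
  using assms(1)
proof induction
  case one
  then show ?case using assms(2) by simp
next
  case (gen x)
  then show ?case by (simp only: mult.assoc adjoin_int.gen)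
next
  case (diff x x')
  then show ?case by (simp only: left_diff_distrib adjoin_int.diff)
qed

text \<open>Multiplication by an element of \<open>\<int>[z]\<close> acts on the vector \<open>(1, z, \<dots>, z\<^sup>m\<^sup>-\<^sup>1)\<close> as an
  integer matrix.\<close>
lemma adjoin_root_of_unity_algebraic_int:
  fixes z :: complex
  assumes z: "z ^ m = 1" and m: "m > 0" and x: "x \<in> adjoin_int z"
  shows "algebraic_int x"
proof -
  have "\<exists>c :: nat \<Rightarrow> nat \<Rightarrow> int. \<forall>i<m. x * z ^ i = (\<Sum>j<m. of_int (c i j) * z ^ j)"
    using x
  proof induction
    case one
    show ?case
    proof (intro exI[of _ "\<lambda>i j. if j = i then 1 else 0"] allI impI)
      fix i assume "i < m"
      have "(\<Sum>j<m. of_int (if j = i then 1 else 0) * z ^ j) = (\<Sum>j<m. if j = i then z ^ j else 0)"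
      proof (rule sum.cong[OF refl])
        fix j show "of_int (if j = i then 1 else 0) * z ^ j = (if j = i then z ^ j else 0)"
          by (cases "j = i") (simp_all only: if_True if_False of_int_1 of_int_0 mult_1 mult_zero_left simp_thms)
      qed
      also have "\<dots> = 1 * z ^ i"
        using \<open>i < m\<close> by (simp only: sum.delta finite_lessThan lessThan_iff if_True mult_1)
      finally show "1 * z ^ i = (\<Sum>j<m. of_int (if j = i then 1 else 0) * z ^ j)" ..
    qed
  next
    case (gen x)
    then obtain c :: "nat \<Rightarrow> nat \<Rightarrow> int" where
      c: "\<And>i. i < m \<Longrightarrow> x * z ^ i = (\<Sum>j<m. of_int (c i j) * z ^ j)" by blast
    \<comment> \<open>Multiplication by \<open>z\<close> shifts the rows of the matrix cyclically
      because \<open>z ^ m = 1\<close>.\<close>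
    have "z * x * z ^ i = (\<Sum>j<m. of_int (c (Suc i mod m) j) * z ^ j)" for i
    proof -
      have "z ^ Suc i = (z ^ m) ^ (Suc i div m) * z ^ (Suc i mod m)"
        by (simp only: mult_div_mod_eq flip: power_mult power_add)
      then have "z ^ Suc i = z ^ (Suc i mod m)" using z by simp
      moreover have "z * x * z ^ i = x * z ^ Suc i" by simp
      ultimately have "z * x * z ^ i = x * z ^ (Suc i mod m)" by (simp only:)
      then show ?thesis using c[of "Suc i mod m"] m by simp
    qed
    then show ?case by (intro exI[of _ "\<lambda>i. c (Suc i mod m)"]) simp
  next
    case (diff x y)
    then obtain c d :: "nat \<Rightarrow> nat \<Rightarrow> int" where
      c: "\<And>i. i < m \<Longrightarrow> x * z ^ i = (\<Sum>j<m. of_int (c i j) * z ^ j)" and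
      d: "\<And>i. i < m \<Longrightarrow> y * z ^ i = (\<Sum>j<m. of_int (d i j) * z ^ j)" by blast
    have "\<forall>i<m. (x - y) * z ^ i = (\<Sum>j<m. of_int (c i j - d i j) * z ^ j)"
      using c d by (simp add: left_diff_distrib sum_subtractf)
    then show ?case by (intro exI[of _ "\<lambda>i j. c i j - d i j"])
  qed
  then obtain c :: "nat \<Rightarrow> nat \<Rightarrow> int" where
    c: "\<And>i. i < m \<Longrightarrow> x * z ^ i = (\<Sum>j<m. of_int (c i j) * z ^ j)" by blast
  define M where "M = mat m m (\<lambda>(i, j). c i j)"
  have M: "M \<in> carrier_mat m m" by (simp add: M_def)
  let ?M = "map_mat of_int M :: complex mat"
  let ?w = "vec m (\<lambda>j. z ^ j)"
  have "eigenvector ?M ?w x"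
    unfolding eigenvector_def
  proof (intro conjI)
    show "?w \<noteq> 0\<^sub>v (dim_row ?M)"
    proof
      assume "?w = 0\<^sub>v (dim_row ?M)"
      then have "?w $ 0 = 0\<^sub>v m $ 0" by (simp add: M_def)
      then show False using m by simp
    qed
    show "?M *\<^sub>v ?w = x \<cdot>\<^sub>v ?w"
      by (rule eq_vecI) (auto simp: M_def scalar_prod_def c atLeast0LessThan)
  qed (simp add: M_def)
  then have "eigenvalue ?M x" unfolding eigenvalue_def by blast
  then have "poly (char_poly ?M) x = 0"
    by (subst (asm) eigenvalue_root_char_poly[of _ m]) (use M in auto)
  moreover have "char_poly ?M = map_poly of_int (char_poly M)"
    using M by (rule of_int_hom.char_poly_hom)
  ultimately show ?thesis
    using degree_monic_char_poly[OF M] unfolding algebraic_int_altdef_ipoly by auto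
qed

text \<open>The ideal generated by \<open>p\<close> is proper: otherwise \<open>1 / p\<close> would
  be a rational algebraic integer, hence an integer. A prime ideal above it then exists.\<close>

lemma ex_prime_ideal_adjoin_root_of_unity:
  fixes z :: complex
  assumes z: "z ^ m = 1" "m > 0" and p: "p > 1"
  shows "\<exists>P. of_nat p \<in> P \<and> subring_prime_ideal (adjoin_int z) P"
proof -
  let ?A = "adjoin_int z"
  define I where "I = {of_nat p * x | x. x \<in> ?A}"
  have "1 \<notin> I"
  proof
    assume "1 \<in> I"
    then obtain x where x: "1 = of_nat p * x" "x \<in> ?A" unfolding I_def by blast
    have "x = 1 / of_nat p" using x(1) p by (simp add: field_simps)
    then have "x \<in> \<rat>" by simp
    then have "x \<in> \<int>"
      using rational_algebraic_int_is_int adjoin_root_of_unity_algebraic_int[OF z x(2)] by blast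
    then obtain k :: int where k: "x = of_int k" by (auto elim: Ints_cases)
    have "of_int (int p * k) = (of_int 1 :: complex)" using x(1) k by simp
    then have "int p * k = 1" by (simp only: of_int_eq_iff)
    then show False using p by (simp add: zmult_eq_1_iff)
  qed
  have "0 \<in> ?A" using adjoin_int.diff[OF adjoin_int.one adjoin_int.one] by simp
  have "of_nat n \<in> ?A" for n
  proof (induction n)
    case (Suc n)
    have "of_nat (Suc n) = of_nat n - (0 - (1::complex))" by simp
    then show ?case using Suc \<open>0 \<in> ?A\<close> by (metis adjoin_int.diff adjoin_int.one)
  qed (use \<open>0 \<in> ?A\<close> in simp)
  have "\<exists>P. I \<subseteq> P \<and> subring_prime_ideal ?A P"
  proof (rule ex_subring_prime_ideal)
    show "I \<subseteq> ?A" unfolding I_def using \<open>of_nat p \<in> ?A\<close> adjoin_int_mult by blast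
    show "0 \<in> I" unfolding I_def using \<open>0 \<in> ?A\<close> by fastforce
    show "x - y \<in> I" if "x \<in> I" "y \<in> I" for x y
      using that unfolding I_def by (auto simp flip: right_diff_distrib intro: adjoin_int.diff)
    show "a * x \<in> I" if "a \<in> ?A" "x \<in> I" for a x
      using that unfolding I_def by (auto simp: mult.left_commute intro: adjoin_int_mult)
  qed (use \<open>1 \<notin> I\<close> in \<open>auto intro: adjoin_int.intros adjoin_int_mult\<close>)
  moreover have "of_nat p \<in> I" unfolding I_def using adjoin_int.one[of z] by fastforce
  ultimately show ?thesis by blast
qed

section \<open>Singer difference sets\<close>

lemma cis_root_of_unity_power_inj:
  assumes "i < n" "j < n" "cis (2 * pi / real n) ^ i = cis (2 * pi / real n) ^ j"
  shows "i = j"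
proof -
  have "n > 0" using assms by simp
  from bij_betw_imp_inj_on[OF bij_betw_roots_unity[OF this]] assms show ?thesis
    by (auto simp: inj_on_def DeMoivre mult.commute)
qed

lemma cis_root_of_unity_power_self: "n > 0 \<Longrightarrow> cis (2 * pi / real n) ^ n = 1"
  by (simp add: DeMoivre)

text \<open>Both sides are monic of degree \<open>n\<close> and vanish at the \<open>n\<close> roots
  of unity. Read modulo a prime ideal, the factorisation locates every solution of
  \<open>x ^ n = 1\<close> among the powers of the root of unity.\<close>

lemma power_minus_one_eq_prod_roots_of_unity:
  assumes "n > 0"
  shows "x ^ n - 1 = (\<Prod>i<n. x - cis (2 * pi / real n) ^ i)"
proof -
  let ?z = "cis (2 * pi / real n)"
  let ?f = "\<Prod>i<n. [:- (?z ^ i), 1:]"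
  let ?g = "monom 1 n - 1 :: complex poly"
  have inj: "inj_on (\<lambda>i. ?z ^ i) {..<n}"
    using cis_root_of_unity_power_inj by (auto simp: inj_on_def)
  have deg: "degree ?f = n"
    by (subst degree_prod_eq_sum_degree) auto
  have "?g = ?f"
  proof (rule poly_eqI_degree_lead_coeff)
    show "degree ?g \<le> n" by (intro degree_diff_le) (auto simp: degree_monom_le)
    show "degree ?f \<le> n" using deg by simp
    have "lead_coeff ?f = 1" by (simp add: lead_coeff_prod)
    then show "coeff ?g n = coeff ?f n" using deg assms by (simp add: coeff_1)
    show "card ((\<lambda>i. ?z ^ i) ` {..<n}) \<ge> n" using card_image[OF inj] by simp
    fix y assume "y \<in> (\<lambda>i. ?z ^ i) ` {..<n}"
    then obtain i where i: "i < n" "y = ?z ^ i" by auto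
    have "y ^ n = (?z ^ n) ^ i" unfolding i(2) by (simp add: mult.commute flip: power_mult)
    then have "y ^ n = 1" using cis_root_of_unity_power_self[OF assms] by simp
    moreover have "poly ?f y = 0"
      using i by (auto simp: poly_prod)
    ultimately show "poly ?g y = poly ?f y" by (simp add: poly_monom)
  qed
  then have "poly ?g x = poly ?f x" by simp
  then show ?thesis by (simp add: poly_monom poly_prod)
qed

lemma quadratic_form_coeffs:
  fixes c d :: "'a::comm_ring_1"
  shows "(c * (s1 * s2) - d * (s3 * s4)) * x\<^sup>2 +
      (c * (s1 * a2 + a1 * s2) - d * (s3 * a4 + a3 * s4)) * x + (c * (a1 * a2) - d * (a3 * a4)) =
    c * ((s1 * x + a1) * (s2 * x + a2)) - d * ((s3 * x + a3) * (s4 * x + a4))"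
  by (simp add: algebra_simps power2_eq_square)

text \<open>The homogeneous form with the coefficients of \<open>quadratic_form_coeffs\<close>,
  evaluated at \<open>(a1, - s1)\<close>. This is the zero of the first linear form, so the
  \<open>c\<close>-term disappears.\<close>

lemma quadratic_form_at_root:
  fixes c d :: "'a::comm_ring_1"
  shows "a1 * a1 * (c * (s1 * s2) - d * (s3 * s4))
      - a1 * s1 * (c * (s1 * a2 + a1 * s2) - d * (s3 * a4 + a3 * s4))
      + s1 * s1 * (c * (a1 * a2) - d * (a3 * a4)) =
    - (d * ((s3 * a1 - s1 * a3) * (s4 * a1 - s1 * a4)))"
  by (simp add: algebra_simps)

text \<open>\<open>\<int>[z]/P\<close> is the field with \<open>q\<^sup>3\<close> elements, and the set \<open>E\<close> below is the preimage of its
  subfield with \<open>q\<close> elements.\<close>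
locale cyclotomic_residue_field = subring_prime_ideal "adjoin_int z" P
  for z :: complex and P :: "complex set" +
  fixes p k q :: nat
  assumes p: "prime p" and p_in_P: "of_nat p \<in> P" and k: "k > 0" and q: "q = p ^ k"
    and z: "z = cis (2 * pi / real (q ^ 3 - 1))"
begin

abbreviation A where "A \<equiv> adjoin_int z"

lemma q_ge_2: "q \<ge> 2"
  using prime_ge_2_nat[OF p] self_le_power[of p k] k unfolding q by linarith

text \<open>The number of points of the projective plane over the field with \<open>q\<close>
  elements, and the index of its multiplicative group in that of the field with \<open>q ^ 3\<close>
  elements.\<close>

definition N where "N = q\<^sup>2 + q + 1"

lemma q_cube: "q ^ 3 - 1 = (q - 1) * N"
  unfolding N_def
proof -
  obtain r where "q = Suc r" using q_ge_2 by (cases q) auto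
  then show "q ^ 3 - 1 = (q - 1) * (q\<^sup>2 + q + 1)" by (simp add: power3_eq_cube power2_eq_square algebra_simps)
qed

lemma q_cube_gt: "q\<^sup>2 + 1 < q ^ 3"
proof -
  have "q\<^sup>2 \<ge> 4" using power_mono[OF q_ge_2, of 2] by simp
  moreover have "q ^ 3 \<ge> 2 * q\<^sup>2"
    using q_ge_2 by (simp add: power3_eq_cube power2_eq_square)
  ultimately show ?thesis by simp
qed

section \<open>Powers of the root of unity modulo the prime ideal\<close>

lemma z_power_order: "z ^ (q ^ 3 - 1) = 1"
  unfolding z by (rule cis_root_of_unity_power_self) (use q_cube_gt in simp)

lemma z_in_A: "z \<in> A"
  using adjoin_int.gen[OF adjoin_int.one, of z] by simp

lemma z_power_in_A: "z ^ i \<in> A"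
  by (intro power_A z_in_A)

lemma z_power_notin_P: "z ^ i \<notin> P"
proof
  assume "z ^ i \<in> P"
  then have "z \<in> P" using prime_P_power z_in_A by blast
  then have "z ^ (q ^ 3 - 2) * z \<in> P" using mult_P power_A z_in_A by blast
  moreover have "z ^ (q ^ 3 - 2) * z = z ^ (q ^ 3 - 1)"
  proof -
    have "Suc (q ^ 3 - 2) = q ^ 3 - 1" using q_cube_gt by simp
    then show ?thesis by (simp only: flip: power_Suc2)
  qed
  ultimately show False using one_notin_P z_power_order by simp
qed

text \<open>If \<open>d > 0\<close>, the powers of \<open>z ^ d\<close> with exponents below
  \<open>q ^ 3 - 1\<close> sum to 0. Modulo \<open>P\<close> each of them is 1, so
  \<open>q ^ 3 - 1\<close> lies in \<open>P\<close>; since \<open>q ^ 3\<close> does too, so would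
  1.\<close>

lemma z_power_eqv_one:
  assumes d: "d < q ^ 3 - 1" and eqv: "z ^ d \<approx> 1"
  shows "d = 0"
proof (rule ccontr)
  assume "d \<noteq> 0"
  let ?m = "q ^ 3 - 1"
  have zd: "z ^ d \<noteq> 1"
    using cis_root_of_unity_power_inj[OF d, of 0, folded z] d \<open>d \<noteq> 0\<close> by fastforce
  have "(z ^ d) ^ ?m = (z ^ ?m) ^ d" by (simp add: mult.commute flip: power_mult)
  then have "(\<Sum>j<?m. (z ^ d) ^ j) = 0"
    using zd z_power_order by (simp add: geometric_sum)
  moreover have "(\<Sum>j<?m. (z ^ d) ^ j - 1) \<in> P"
  proof (rule sum_P)
    fix j
    show "(z ^ d) ^ j - 1 \<in> P"
      using eqv_power[OF eqv z_power_in_A one_A, of j] by (simp add: eqv_def)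
  qed
  ultimately have "- of_nat ?m \<in> P" by (simp add: sum_subtractf)
  moreover have "of_nat (q ^ 3) \<in> P"
  proof -
    have "q ^ 3 = p ^ (3 * k)" unfolding q by (simp add: mult.commute flip: power_mult)
    also have "\<dots> = p ^ (3 * k - 1) * p" using k by (simp flip: power_Suc2)
    finally show ?thesis using mult_P[OF of_nat_A p_in_P] by (simp only: of_nat_mult)
  qed
  ultimately have "- of_nat ?m + of_nat (q ^ 3) \<in> P" by (rule add_P)
  then show False using one_notin_P q_ge_2 by (simp add: of_nat_diff)
qed

lemma z_power_eqv_le:
  assumes "i \<le> j" "z ^ i \<approx> z ^ j"
  shows "(q ^ 3 - 1) dvd j - i"
proof -
  let ?m = "q ^ 3 - 1"
  have "z ^ i * 1 \<approx> z ^ i * z ^ (j - i)" using assms by (simp flip: power_add)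
  then have "1 \<approx> z ^ (j - i)"
    by (rule eqv_mult_left_cancel) (auto simp: z_power_in_A z_power_notin_P one_A)
  also have "z ^ (j - i) = (z ^ ?m) ^ ((j - i) div ?m) * z ^ ((j - i) mod ?m)"
    by (simp only: mult_div_mod_eq flip: power_mult power_add)
  also have "\<dots> = z ^ ((j - i) mod ?m)" using z_power_order by simp
  finally have "z ^ ((j - i) mod ?m) \<approx> 1" by (rule eqv_sym)
  then have "(j - i) mod ?m = 0"
    using z_power_eqv_one q_cube_gt by simp
  then show ?thesis by auto
qed

lemma z_power_eqv_cong:
  assumes "z ^ i \<approx> z ^ j"
  shows "[i = j] (mod (q ^ 3 - 1))"
proof (cases "i \<le> j")
  case True
  from z_power_eqv_le[OF this assms] show ?thesis
    using True cong_altdef_nat cong_sym by blast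
next
  case False
  with z_power_eqv_le[of j i] eqv_sym[OF assms] show ?thesis
    by (simp add: cong_altdef_nat)
qed

lemma z_power_eqv_inj:
  assumes "z ^ i \<approx> z ^ j" "i < q ^ 3 - 1" "j < q ^ 3 - 1"
  shows "i = j"
  using z_power_eqv_cong[OF assms(1)] assms(2,3) by (simp add: cong_def)

lemma diff_power_q: "x \<in> A \<Longrightarrow> y \<in> A \<Longrightarrow> (x - y) ^ q \<approx> x ^ q - y ^ q"
  unfolding q by (intro eqv_diff_power_prime_power p p_in_P)

lemma add_power_q: "x \<in> A \<Longrightarrow> y \<in> A \<Longrightarrow> (x + y) ^ q \<approx> x ^ q + y ^ q"
  unfolding q by (intro eqv_add_power_prime_power p p_in_P)

text \<open>Raising to the power \<open>q ^ 3\<close> is additive and multiplicative modulo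
  \<open>P\<close> and fixes \<open>z\<close>, so it fixes all of \<open>A\<close>.\<close>

lemma power_q_cube:
  assumes "x \<in> A"
  shows "x ^ (q ^ 3) \<approx> x"
  using assms
proof induction
  case one
  then show ?case by simp
next
  case (gen x)
  have "z ^ (q ^ 3) = z ^ (q ^ 3 - 1) * z"
    using q_ge_2 by (simp flip: power_Suc2)
  then have "(z * x) ^ (q ^ 3) = z * x ^ (q ^ 3)"
    using z_power_order by (simp add: power_mult_distrib)
  also have "\<dots> \<approx> z * x"
    using gen z_in_A by (intro eqv_mult power_A) auto
  finally show ?case .
next
  case (diff x y)
  have "q ^ 3 = p ^ (k * 3)" unfolding q by (simp flip: power_mult)
  then have "(x - y) ^ (q ^ 3) \<approx> x ^ (q ^ 3) - y ^ (q ^ 3)"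
    using eqv_diff_power_prime_power[OF p p_in_P, of x y "k * 3"] diff by simp
  also have "\<dots> \<approx> x - y" by (intro eqv_diff diff)
  finally show ?case .
qed

text \<open>\<open>x ^ (q ^ 3 - 1) - 1\<close> lies in \<open>P\<close> and factors as the product
  of the \<open>x - z ^ i\<close>; primality selects a factor. Thus discrete logarithms to base
  \<open>z\<close> exist.\<close>

lemma ex_z_power_eqv:
  assumes "x \<in> A" "x \<notin> P"
  shows "\<exists>i. x \<approx> z ^ i"
proof -
  let ?m = "q ^ 3 - 1"
  have m: "?m > 0" using q_cube_gt by simp
  have "x * (x ^ ?m - 1) = x ^ (q ^ 3) - x"
    using q_ge_2 by (simp add: right_diff_distrib flip: power_Suc)
  then have "x * (x ^ ?m - 1) \<in> P" using power_q_cube[OF assms(1)] by (simp add: eqv_def)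
  then have "x ^ ?m - 1 \<in> P" using prime_P assms by (meson diff_A one_A power_A)
  then have "(\<Prod>i<?m. x - z ^ i) \<in> P"
    using power_minus_one_eq_prod_roots_of_unity[OF m, of x] by (simp add: z)
  then obtain i where "x - z ^ i \<in> P"
    using prime_P_prod[of "{..<?m}" "\<lambda>i. x - z ^ i"] assms(1) diff_A z_power_in_A by blast
  then show ?thesis by (auto simp: eqv_def)
qed

section \<open>The subfield with \<open>q\<close> elements\<close>

definition E where "E = {x \<in> A. x ^ q \<approx> x}"

lemma E_in_A: "x \<in> E \<Longrightarrow> x \<in> A"
  by (simp add: E_def)

lemma zero_E: "0 \<in> E"
  using q_ge_2 by (simp add: E_def zero_A zero_power)

lemma one_E: "1 \<in> E"
  by (simp add: E_def one_A)

lemma diff_E: "x \<in> E \<Longrightarrow> y \<in> E \<Longrightarrow> x - y \<in> E"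
  unfolding E_def using eqv_trans[OF diff_power_q eqv_diff] by (simp add: diff_A)

lemma add_E: "x \<in> E \<Longrightarrow> y \<in> E \<Longrightarrow> x + y \<in> E"
  unfolding E_def using eqv_trans[OF add_power_q eqv_add] by (simp add: add_A)

lemma mult_E: "x \<in> E \<Longrightarrow> y \<in> E \<Longrightarrow> x * y \<in> E"
  unfolding E_def by (auto simp: power_mult_distrib intro!: eqv_mult mult_A power_A)

text \<open>\<open>N * t * (q - 1)\<close> is a multiple of the order \<open>q ^ 3 - 1\<close> of
  \<open>z\<close>.\<close>

lemma z_power_E: "z ^ (N * t) \<in> E"
proof -
  have "N * t * q = (q ^ 3 - 1) * t + N * t"
  proof -
    have "N * t * (q - 1 + 1) = (q - 1) * N * t + N * t" by (simp add: algebra_simps)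
    then show ?thesis using q_ge_2 unfolding q_cube by simp
  qed
  then have "(z ^ (N * t)) ^ q = (z ^ (q ^ 3 - 1)) ^ t * z ^ (N * t)"
    by (simp only: flip: power_mult power_add)
  also have "\<dots> = z ^ (N * t)"
    by (simp only: z_power_order power_one mult_1)
  finally show ?thesis using z_power_in_A by (simp add: E_def)
qed

lemma quadratic_power_q:
  assumes "s \<in> E" "t \<in> E" "u \<in> E" "x \<in> A"
  shows "(s * x\<^sup>2 + t * x + u) ^ q \<approx> s * (x ^ q)\<^sup>2 + t * x ^ q + u"
proof -
  have in_A: "s \<in> A" "t \<in> A" "u \<in> A" using assms E_in_A by auto
  note in_A' = in_A \<open>x \<in> A\<close> mult_A add_A power_A
  have E: "s ^ q \<approx> s" "t ^ q \<approx> t" "u ^ q \<approx> u" using assms by (auto simp: E_def)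
  have "(s * x\<^sup>2 + t * x + u) ^ q \<approx> (s * x\<^sup>2 + t * x) ^ q + u ^ q"
    by (intro add_power_q in_A')
  also have "\<dots> \<approx> ((s * x\<^sup>2) ^ q + (t * x) ^ q) + u ^ q"
    by (intro eqv_add add_power_q eqv_refl in_A')
  also have "\<dots> = s ^ q * (x ^ q)\<^sup>2 + t ^ q * x ^ q + u ^ q"
    by (simp add: power_mult_distrib mult.commute flip: power_mult)
  also have "\<dots> \<approx> s * (x ^ q)\<^sup>2 + t * x ^ q + u"
    by (intro eqv_add eqv_mult E eqv_refl in_A')
  finally show ?thesis .
qed

text \<open>The Frobenius conjugates \<open>z\<close>, \<open>z\<^sup>q\<close>, \<open>(z\<^sup>q)\<^sup>q\<close> would be three distinct roots of the
  quadratic.\<close>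
lemma quadratic_independent:
  assumes stu: "s \<in> E" "t \<in> E" "u \<in> E" and root: "s * z\<^sup>2 + t * z + u \<in> P"
  shows "s \<in> P" "t \<in> P" "u \<in> P"
proof -
  have in_A: "s \<in> A" "t \<in> A" "u \<in> A" using stu E_in_A by auto
  define F where "F x = s * x\<^sup>2 + t * x + u" for x
  have F_step: "F (x ^ q) \<in> P" if "x \<in> A" "F x \<in> P" for x
  proof -
    have "F x ^ q \<in> P"
      using that q_ge_2 mult_P[OF power_A[of "F x" "q - 1"], of "F x"] P_subset
      by (auto simp flip: power_Suc2)
    then show ?thesis
      using quadratic_power_q[OF stu that(1)] eqv_in_P eqv_sym unfolding F_def by blast
  qed
  define w v where "w = z ^ q" and "v = w ^ q"
  have A: "w \<in> A" "v \<in> A" by (simp_all add: w_def v_def power_A z_in_A)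
  have F: "F z \<in> P" "F w \<in> P" "F v \<in> P"
    using root F_step z_in_A A unfolding F_def[of z] w_def v_def by (auto simp: F_def)
  have v: "v = z ^ q\<^sup>2" by (simp add: v_def w_def power2_eq_square flip: power_mult)
  have q2: "1 < q" "q < q\<^sup>2" "q\<^sup>2 < q ^ 3 - 1"
    using q_ge_2 q_cube_gt by (auto simp: power2_eq_square)
  have "\<not> z \<approx> w" using z_power_eqv_inj[of 1 q] q2 unfolding w_def by fastforce
  moreover have "\<not> z \<approx> v" using z_power_eqv_inj[of 1 "q\<^sup>2"] q2 unfolding v by fastforce
  moreover have "\<not> w \<approx> v" using z_power_eqv_inj[of q "q\<^sup>2"] q2 unfolding v w_def by fastforce
  ultimately have distinct: "z - w \<notin> P" "z - v \<notin> P" "w - v \<notin> P"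
    by (auto simp: eqv_def)
  \<comment> \<open>Divided difference of \<open>F\<close>. Subtracting two of these linear
    relations isolates \<open>s\<close>, then \<open>t\<close> and \<open>u\<close> follow.\<close>
  have lin: "s * (x + y) + t \<in> P" if "F x \<in> P" "F y \<in> P" "x - y \<notin> P" "x \<in> A" "y \<in> A" for x y
  proof -
    have "(x - y) * (s * (x + y) + t) = F x - F y"
      unfolding F_def by (simp add: algebra_simps power2_eq_square)
    then have "(x - y) * (s * (x + y) + t) \<in> P" using that diff_P by simp
    then show ?thesis using prime_P[of "x - y"] that in_A by (auto simp: add_A diff_A mult_A)
  qed
  have zw: "s * (z + w) + t \<in> P" and zv: "s * (z + v) + t \<in> P"
    using lin F distinct A z_in_A by auto
  have "s * (w - v) \<in> P" using diff_P[OF zw zv] by (simp add: algebra_simps)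
  then show s: "s \<in> P" using prime_P in_A distinct A diff_A by blast
  have "t = (s * (z + w) + t) - (z + w) * s" by (simp add: algebra_simps)
  then show t: "t \<in> P" using diff_P[OF zw mult_P[OF add_A[OF z_in_A A(1)] s]] by simp
  have "u = (s * z\<^sup>2 + t * z + u) - (z\<^sup>2 * s + z * t)" by (simp add: algebra_simps)
  also have "\<dots> \<in> P" by (intro diff_P root add_P mult_P s t power_A z_in_A)
  finally show "u \<in> P" .
qed

text \<open>Homogeneous coordinates of the \<open>q + 1\<close> linear forms \<open>z + a\<close> (indices \<open>i < q\<close>, where \<open>a\<close> runs
  through representatives of the subfield) and \<open>1\<close> (index \<open>q\<close>).\<close>
definition coeff1 :: "nat \<Rightarrow> complex" where
  "coeff1 i = (if i < q then 1 else 0)"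

text \<open>Index 0 stands for the zero of the subfield; the shift by one makes the other indices
  below \<open>q\<close> run through the \<open>q - 1\<close> nonzero residues
  \<open>1, z ^ N, (z ^ N) ^ 2, ...\<close>.\<close>

definition coeff0 :: "nat \<Rightarrow> complex" where
  "coeff0 i = (if i = 0 then 0 else if i < q then z ^ (N * (i - 1)) else 1)"

lemma coeffs_E: "coeff1 i \<in> E" "coeff0 i \<in> E"
  unfolding coeff1_def coeff0_def using zero_E one_E z_power_E by auto

lemma coeff0_inj:
  assumes "i < q" "j < q" "coeff0 i \<approx> coeff0 j"
  shows "i = j"
proof -
  have nz: "\<not> 0 \<approx> z ^ n" for n
    using z_power_notin_P[of n] eqv_sym eqv_zero_iff by blast
  have lt: "N * (l - 1) < q ^ 3 - 1" if "l \<noteq> 0" "l < q" for l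
  proof -
    have "N > 0" "l - 1 < q - 1" using that by (auto simp: N_def)
    then show ?thesis unfolding q_cube mult.commute[of _ N] by simp
  qed
  have "i - 1 = j - 1" if ij: "i \<noteq> 0" "j \<noteq> 0"
  proof -
    have "N * (i - 1) = N * (j - 1)"
    proof (rule z_power_eqv_inj)
      show "z ^ (N * (i - 1)) \<approx> z ^ (N * (j - 1))"
        using ij assms by (simp add: coeff0_def)
    qed (use lt assms ij in auto)
    moreover have "N \<noteq> 0" by (simp add: N_def)
    ultimately show ?thesis by simp
  qed
  moreover have "False" if "i = 0" "j \<noteq> 0"
    using that assms nz by (simp add: coeff0_def)
  moreover have "False" if "i \<noteq> 0" "j = 0"
    using that assms eqv_sym[OF assms(3)] nz by (simp add: coeff0_def)
  ultimately have "(i = 0 \<longleftrightarrow> j = 0) \<and> (i \<noteq> 0 \<longrightarrow> j \<noteq> 0 \<longrightarrow> i - 1 = j - 1)"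
    by auto
  then show ?thesis by (cases i; cases j) auto
qed

text \<open>A vanishing determinant means proportional linear forms, and the \<open>q + 1\<close>
  forms represent distinct points of a projective line.\<close>

lemma coeffs_proportional:
  assumes "i \<le> q" "j \<le> q" "coeff1 j * coeff0 i - coeff1 i * coeff0 j \<in> P"
  shows "i = j"
proof (cases "i < q \<and> j < q")
  case True
  then show ?thesis using assms coeff0_inj by (auto simp: coeff1_def eqv_def)
next
  case False
  moreover have "-1 \<notin> P" using uminus_P[of "-1"] one_notin_P by auto
  ultimately show ?thesis
    using assms one_notin_P q_ge_2 by (auto simp: coeff1_def coeff0_def split: if_splits)
qed

section \<open>The values of the linear forms at \<open>z\<close> and their discrete
  logarithms\<close>

definition point :: "nat \<Rightarrow> complex" where
  "point i = coeff1 i * z + coeff0 i"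

lemma point_in_A: "point i \<in> A"
  unfolding point_def by (intro add_A mult_A z_in_A E_in_A coeffs_E)

lemma point_notin_P: "point i \<notin> P"
proof
  assume "point i \<in> P"
  then have "0 * z\<^sup>2 + coeff1 i * z + coeff0 i \<in> P" by (simp add: point_def)
  from quadratic_independent(2,3)[OF zero_E coeffs_E this]
  have "coeff1 i \<in> P" "coeff0 i \<in> P" by simp_all
  then show False using one_notin_P q_ge_2 by (auto simp: coeff1_def coeff0_def split: if_splits)
qed

text \<open>Unique factorisation of quadratic forms. The difference of the two sides is a quadratic
  in \<open>z\<close> over \<open>E\<close> that vanishes modulo \<open>P\<close>, so its
  coefficients lie in \<open>P\<close>; at the zero of form \<open>i1\<close> this makes form
  \<open>i3\<close> or form \<open>i4\<close> vanish too.\<close>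

lemma point_products:
  assumes c: "c \<in> E" "d \<in> E" "d \<notin> P"
    and eqv: "c * (point i1 * point i2) \<approx> d * (point i3 * point i4)"
    and i: "i1 \<le> q" "i3 \<le> q" "i4 \<le> q"
  shows "i1 = i3 \<or> i1 = i4"
proof -
  let ?s = coeff1 and ?a = coeff0
  define c2 where "c2 = c * (?s i1 * ?s i2) - d * (?s i3 * ?s i4)"
  define c1 where "c1 = c * (?s i1 * ?a i2 + ?a i1 * ?s i2) - d * (?s i3 * ?a i4 + ?a i3 * ?s i4)"
  define c0 where "c0 = c * (?a i1 * ?a i2) - d * (?a i3 * ?a i4)"
  have "c2 * z\<^sup>2 + c1 * z + c0 =
      c * (point i1 * point i2) - d * (point i3 * point i4)"
    unfolding point_def c2_def c1_def c0_def by (rule quadratic_form_coeffs)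
  then have root: "c2 * z\<^sup>2 + c1 * z + c0 \<in> P"
    using eqv by (simp only: eqv_def)
  have E: "c2 \<in> E" "c1 \<in> E" "c0 \<in> E"
    unfolding c2_def c1_def c0_def by (intro diff_E mult_E add_E c coeffs_E)+
  note A = coeffs_E[THEN E_in_A]
  \<comment> \<open>The homogeneous form with coefficients \<open>c2, c1, c0\<close> is evaluated at the zero of the
    linear form \<open>i1\<close>.\<close>
  have "?a i1 * ?a i1 * c2 - ?a i1 * ?s i1 * c1 + ?s i1 * ?s i1 * c0 \<in> P"
    by (rule add_P[OF diff_P]; rule mult_P) (rule mult_A A quadratic_independent[OF E root])+
  moreover have "?a i1 * ?a i1 * c2 - ?a i1 * ?s i1 * c1 + ?s i1 * ?s i1 * c0 =
      - (d * ((?s i3 * ?a i1 - ?s i1 * ?a i3) * (?s i4 * ?a i1 - ?s i1 * ?a i4)))"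
    unfolding c2_def c1_def c0_def by (rule quadratic_form_at_root)
  ultimately have "- (d * ((?s i3 * ?a i1 - ?s i1 * ?a i3) * (?s i4 * ?a i1 - ?s i1 * ?a i4))) \<in> P"
    by (simp only:)
  from uminus_P[OF this]
  have "d * ((?s i3 * ?a i1 - ?s i1 * ?a i3) * (?s i4 * ?a i1 - ?s i1 * ?a i4)) \<in> P"
    by simp
  from prime_P[OF _ _ this] c(2,3)
  have "(?s i3 * ?a i1 - ?s i1 * ?a i3) * (?s i4 * ?a i1 - ?s i1 * ?a i4) \<in> P"
    by (auto simp: E_in_A A diff_A mult_A)
  from prime_P[OF _ _ this]
  have "?s i3 * ?a i1 - ?s i1 * ?a i3 \<in> P \<or> ?s i4 * ?a i1 - ?s i1 * ?a i4 \<in> P"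
    by (auto simp: A diff_A mult_A)
  then show ?thesis using coeffs_proportional i by blast
qed

text \<open>\<open>f i\<close> is the discrete logarithm of \<open>point i\<close>. Equal sums
  modulo \<open>N\<close> mean equal products up to powers of \<open>z ^ N\<close>, which are
  scalars from \<open>E\<close>.\<close>

lemma ex_modular_sidon:
  "\<exists>f :: nat \<Rightarrow> nat. \<forall>i1\<le>q. \<forall>i2\<le>q. \<forall>i3\<le>q. \<forall>i4\<le>q.
    [f i1 + f i2 = f i3 + f i4] (mod N) \<longrightarrow> i1 = i3 \<or> i1 = i4"
proof -
  define f where "f i = (SOME l. point i \<approx> z ^ l)" for i
  have f: "point i \<approx> z ^ f i" for i
    unfolding f_def by (rule someI_ex) (rule ex_z_power_eqv[OF point_in_A point_notin_P])
  have "i1 = i3 \<or> i1 = i4"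
    if i: "i1 \<le> q" "i3 \<le> q" "i4 \<le> q"
      and cong: "[f i1 + f i2 = f i3 + f i4] (mod N)" for i1 i2 i3 i4
  proof -
    obtain s t where st: "f i3 + f i4 + s * N = f i1 + f i2 + t * N"
      using cong_iff_lin_nat[THEN iffD1, OF cong] by auto
    have prod: "z ^ (N * t) * (point i * point j) \<approx> z ^ (f i + f j + t * N)" for i j t
    proof -
      have "z ^ (N * t) * (point i * point j) \<approx> z ^ (N * t) * (z ^ f i * z ^ f j)"
        by (intro eqv_mult f eqv_refl z_power_in_A mult_A point_in_A)
      also have "\<dots> = z ^ (f i + f j + t * N)"
        by (simp add: power_add mult_ac)
      finally show ?thesis .
    qed
    have "z ^ (N * t) * (point i1 * point i2) \<approx> z ^ (f i3 + f i4 + s * N)"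
      unfolding st by (rule prod)
    also have "\<dots> \<approx> z ^ (N * s) * (point i3 * point i4)"
      by (rule eqv_sym, rule prod)
    finally show ?thesis
      using point_products[OF z_power_E z_power_E z_power_notin_P _ i] by blast
  qed
  then show ?thesis by blast
qed

end

text \<open>Only the Sidon property is recorded; that the differences cover every nonzero residue
  follows by counting in \<open>modular_sidon_character_sum\<close>.\<close>

theorem ex_singer_difference_set:
  assumes "primepow q"
  shows "\<exists>f :: nat \<Rightarrow> nat. \<forall>i1\<le>q. \<forall>i2\<le>q. \<forall>i3\<le>q. \<forall>i4\<le>q.
    [f i1 + f i2 = f i3 + f i4] (mod (q\<^sup>2 + q + 1)) \<longrightarrow> i1 = i3 \<or> i1 = i4"
proof -
  obtain p k where pk: "prime p" "k > 0" "q = p ^ k"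
    using assms unfolding primepow_def by blast
  define z where "z = cis (2 * pi / real (q ^ 3 - 1))"
  have "q \<ge> 2" using prime_ge_2_nat[OF pk(1)] self_le_power[of p k] pk by linarith
  then have "q ^ 3 - 1 > 0" using power_mono[of 2 q 3] by simp
  then have "z ^ (q ^ 3 - 1) = 1" unfolding z_def by (rule cis_root_of_unity_power_self)
  then obtain P where P: "of_nat p \<in> P" "subring_prime_ideal (adjoin_int z) P"
    using ex_prime_ideal_adjoin_root_of_unity \<open>q ^ 3 - 1 > 0\<close> prime_gt_1_nat[OF pk(1)] by blast
  interpret subring_prime_ideal "adjoin_int z" P by fact
  interpret cyclotomic_residue_field z P p k q
    by unfold_locales (use pk P in \<open>auto simp: z_def\<close>)
  show ?thesis using ex_modular_sidon unfolding N_def .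
qed

section \<open>Equiangular lines from difference sets\<close>

text \<open>The \<open>(q + 1) q\<close> differences of distinct elements of a Sidon set of size \<open>q + 1\<close> run through all
  nonzero residues modulo \<open>q\<^sup>2 + q + 1\<close>.\<close>
lemma modular_sidon_character_sum:
  fixes f :: "nat \<Rightarrow> nat"
  assumes N_def: "N = q\<^sup>2 + q + 1"
    and sidon: "\<And>i1 i2 i3 i4. i1 \<le> q \<Longrightarrow> i2 \<le> q \<Longrightarrow> i3 \<le> q \<Longrightarrow> i4 \<le> q \<Longrightarrow>
      [f i1 + f i2 = f i3 + f i4] (mod N) \<Longrightarrow> i1 = i3 \<or> i1 = i4"
    and w: "w ^ N = 1" "w \<noteq> 1" "cmod w = 1"
  shows "(\<Sum>i\<le>q. w ^ f i) * cnj (\<Sum>i\<le>q. w ^ f i) = of_nat q"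
proof -
  have cnj_w: "w * cnj w = 1" using w(3) by (simp add: complex_norm_square[symmetric])
  have N: "N > 0" by (simp add: N_def)
  define g where "g = (\<lambda>(i, j). nat ((int (f i) - int (f j)) mod int N))"
  let ?D = "{..q} \<times> {..q} - Id"
  have g_cong: "[int (g (i, j)) + int (f j) = int (f i)] (mod int N)" for i j
    unfolding g_def using N by (simp add: cong_def mod_simps)
  have inj: "inj_on g ?D"
  proof (rule inj_onI)
    fix x y assume xy: "x \<in> ?D" "y \<in> ?D" "g x = g y"
    obtain i j i' j' where ij: "x = (i, j)" "y = (i', j')" by (cases x, cases y)
    have bounds: "i \<le> q" "j \<le> q" "i' \<le> q" "j' \<le> q" "i \<noteq> j" "i' \<noteq> j'" using xy ij by auto
    have "[int (f i) + int (f j') = (int (g (i, j)) + int (f j)) + int (f j')] (mod int N)"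
      by (intro cong_add cong_refl cong_sym[OF g_cong])
    also have "(int (g (i, j)) + int (f j)) + int (f j') = (int (g (i', j')) + int (f j')) + int (f j)"
      using xy(3) ij by simp
    also have "[\<dots> = int (f i') + int (f j)] (mod int N)"
      by (intro cong_add cong_refl g_cong)
    finally have c: "[f i + f j' = f i' + f j] (mod N)" by (simp flip: of_nat_add add: cong_int_iff)
    then have "i = i' \<or> i = j" using sidon bounds by blast
    \<comment> \<open>The same congruence with the summands on the left exchanged.\<close>
    moreover have "j' = i' \<or> j' = j"
      using sidon[of j' i i' j] c bounds by (simp add: add.commute)
    ultimately show "x = y" using bounds ij by auto
  qed
  have sub: "g ` ?D \<subseteq> {1..<N}"
  proof
    fix t assume "t \<in> g ` ?D"
    then obtain i j where ij: "i \<le> q" "j \<le> q" "i \<noteq> j" "t = g (i, j)" by auto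
    have "t \<noteq> 0"
    proof
      assume "t = 0"
      then have "[f j = f i] (mod N)" using g_cong[of i j] ij by (simp add: cong_int_iff)
      then have "[f j + f i = f i + f i] (mod N)" by (intro cong_add) auto
      then show False using sidon ij by blast
    qed
    moreover have "t < N" using ij(4) N by (simp add: g_def nat_less_iff)
    ultimately show "t \<in> {1..<N}" by simp
  qed
  have "card ?D = N - 1"
  proof -
    have "card ({..q} \<times> {..q} \<inter> Id) = card ((\<lambda>i. (i, i)) ` {..q})"
      by (rule arg_cong[of _ _ card]) auto
    also have "\<dots> = q + 1" by (subst card_image) (auto simp: inj_on_def)
    finally show ?thesis
      by (simp add: card_Diff_subset_Int N_def power2_eq_square)
  qed
  then have bij: "bij_betw g ?D {1..<N}"
    using inj sub card_subset_eq[of "{1..<N}" "g ` ?D"] card_image[OF inj]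
    by (simp add: bij_betw_def)
  have wg: "w ^ f i * cnj (w ^ f j) = w ^ g (i, j)" for i j
  proof -
    have "[int (g (i, j) + f j) = int (f i)] (mod int N)" using g_cong by simp
    then have "[g (i, j) + f j = f i] (mod N)" by (simp only: cong_int_iff)
    then obtain s t where "f i + s * N = g (i, j) + f j + t * N"
      unfolding cong_iff_lin_nat by blast
    then have "w ^ f i * (w ^ N) ^ s = w ^ g (i, j) * w ^ f j * (w ^ N) ^ t"
      by (metis mult.commute power_add power_mult)
    then have "w ^ f i = w ^ g (i, j) * w ^ f j" using w by simp
    then have "w ^ f i * cnj (w ^ f j) = w ^ g (i, j) * (w * cnj w) ^ f j"
      by (simp add: power_mult_distrib)
    then show ?thesis using cnj_w by simp
  qed
  \<comment> \<open>The diagonal contributes \<open>q + 1\<close>. The other pairs hit each nonzero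
    residue once and contribute -1, the full geometric sum being 0.\<close>
  have "(\<Sum>i\<le>q. w ^ f i) * cnj (\<Sum>i\<le>q. w ^ f i) = (\<Sum>i\<le>q. \<Sum>j\<le>q. w ^ f i * cnj (w ^ f j))"
    by (simp add: sum_product)
  also have "\<dots> = (\<Sum>x\<in>{..q} \<times> {..q}. w ^ g x)"
    by (simp add: wg sum.cartesian_product split_def del: complex_cnj_power)
  also have "\<dots> = (\<Sum>x\<in>?D. w ^ g x) + (\<Sum>x\<in>{..q} \<times> {..q} \<inter> Id. w ^ g x)"
    by (subst sum.Int_Diff[of _ _ Id]) (auto simp: add.commute)
  also have "(\<Sum>x\<in>{..q} \<times> {..q} \<inter> Id. w ^ g x) = (\<Sum>i\<le>q. w ^ g (i, i))"
    by (rule sum.reindex_bij_witness[of _ "\<lambda>i. (i, i)" fst]) auto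
  also have "\<dots> = of_nat (q + 1)" by (simp add: g_def)
  also have "(\<Sum>x\<in>?D. w ^ g x) = (\<Sum>t\<in>{1..<N}. w ^ t)"
    by (rule sum.reindex_bij_betw[OF bij])
  also have "\<dots> = -1"
  proof -
    have "(\<Sum>t<N. w ^ t) = 0" using w by (simp add: geometric_sum)
    moreover have "{..<N} = insert 0 {1..<N}" using N by auto
    ultimately have "1 + (\<Sum>t\<in>{1..<N}. w ^ t) = 0" by simp
    then show ?thesis by (simp add: eq_neg_iff_add_eq_0 add.commute)
  qed
  finally show ?thesis by simp
qed

section \<open>Lines spanned by restricted characters\<close>

lemma cscalar_prod_eq_sum:
  assumes "v \<in> carrier_vec r" "w \<in> carrier_vec r"
  shows "v \<bullet>c w = (\<Sum>k<r. v $ k * cnj (w $ k))"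
  using assms by (simp add: scalar_prod_def atLeast0LessThan)

lemma complex_line_span:
  assumes v: "v \<in> carrier_vec r" "v \<noteq> 0\<^sub>v r"
  shows "complex_line r {c \<cdot>\<^sub>v v | c. True}"
proof -
  interpret V: vec_space "TYPE(complex)" r .
  let ?l = "V.span {v}"
  have span: "?l = {c \<cdot>\<^sub>v v | c. True}"
  proof
    show "?l \<subseteq> {c \<cdot>\<^sub>v v | c. True}"
    proof
      fix x assume "x \<in> ?l"
      then obtain a where "x = V.lincomb a {v}"
        using V.finite_in_span[of "{v}" x] v by auto
      moreover have "V.lincomb a {v} = a v \<cdot>\<^sub>v v"
        using v by (simp add: V.lincomb_def)
      ultimately show "x \<in> {c \<cdot>\<^sub>v v | c. True}" by blast
    qed
    show "{c \<cdot>\<^sub>v v | c. True} \<subseteq> ?l"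
      using v V.smult_in_span[of "{v}" v] V.span_mem[of "{v}" v] by auto
  qed
  have sub: "VectorSpace.subspace class_ring ?l V.V"
    using v by (intro V.span_is_subspace) auto
  have vs: "vectorspace class_ring (V.vs ?l)"
    using V.subspace_is_vs[OF sub] .
  interpret L: vectorspace class_ring "V.vs ?l" by (rule vs)
  have vl: "v \<in> ?l" using V.span_mem[of "{v}" v] v by auto
  have li: "\<not> V.lin_dep {v}"
  proof
    assume "V.lin_dep {v}"
    then obtain a where a: "V.lincomb a {v} = 0\<^sub>v r" "a v \<noteq> 0"
      using V.finite_lin_dep[of "{v}"] v by auto
    then have "a v \<cdot>\<^sub>v v = 0\<^sub>v r" using v by (simp add: V.lincomb_def)
    moreover have "v = (1 / a v) \<cdot>\<^sub>v (a v \<cdot>\<^sub>v v)" using a(2) v by (auto simp: smult_smult_assoc)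
    ultimately have "v = (1 / a v) \<cdot>\<^sub>v 0\<^sub>v r" by simp
    then show False using v by auto
  qed
  have subm: "submodule class_ring ?l V.V" using sub by (simp add: VectorSpace.subspace_def)
  have "L.basis {v}"
    unfolding L.basis_def
    using V.span_li_not_depend[of "{v}" ?l] li v vl subm by auto
  from L.dim_basis[OF _ this] have "L.dim = 1" by simp
  then show ?thesis using sub unfolding complex_line_def span by blast
qed

text \<open>Up to the factor \<open>1 / (q + 1)\<close>, the inner product of two restricted
  characters is a character sum over the difference set, of modulus \<open>sqrt q\<close>.\<close>

lemma ex_equiangular_singer:
  assumes q: "primepow q" and r: "q + 1 \<le> r"
  shows "\<exists>l. complex_equiangular r (sqrt (real q) / (real q + 1)) (q\<^sup>2 + q + 1) l"
proof -
  define N where "N = q\<^sup>2 + q + 1"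
  obtain f :: "nat \<Rightarrow> nat" where f: "\<And>i1 i2 i3 i4. i1 \<le> q \<Longrightarrow> i2 \<le> q \<Longrightarrow> i3 \<le> q \<Longrightarrow> i4 \<le> q \<Longrightarrow>
      [f i1 + f i2 = f i3 + f i4] (mod N) \<Longrightarrow> i1 = i3 \<or> i1 = i4"
    using ex_singer_difference_set[OF q] unfolding N_def by blast
  define \<omega> where "\<omega> = cis (2 * pi / real N)"
  have N: "N > 0" by (simp add: N_def)
  have \<omega>: "\<omega> ^ N = 1" unfolding \<omega>_def by (rule cis_root_of_unity_power_self[OF N])
  have norm_\<omega>: "cmod (\<omega> ^ i) = 1" for i by (simp add: \<omega>_def norm_power)
  define c where "c = complex_of_real (1 / sqrt (real q + 1))"
  have c: "c * cnj c = 1 / (of_nat q + 1)"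
  proof -
    have "c * cnj c = of_real (1 / sqrt (real q + 1) * (1 / sqrt (real q + 1)))"
      unfolding c_def complex_cnj_complex_of_real of_real_mult ..
    also have "1 / sqrt (real q + 1) * (1 / sqrt (real q + 1)) = 1 / (real q + 1)"
      by simp
    finally show ?thesis by simp
  qed
  \<comment> \<open>Padding by zeros covers every dimension from \<open>q + 1\<close>
    upwards.\<close>
  define v where "v i = vec r (\<lambda>s. if s \<le> q then c * \<omega> ^ (i * f s) else 0)" for i
  have v: "v i \<in> carrier_vec r" for i by (simp add: v_def)
  have ip: "v i \<bullet>c v j = (\<Sum>s\<le>q. (\<omega> ^ i * cnj (\<omega> ^ j)) ^ f s) / (of_nat q + 1)" for i j
  proof -
    have "v i \<bullet>c v j = (\<Sum>s<r. if s \<le> q then c * \<omega> ^ (i * f s) * cnj (c * \<omega> ^ (j * f s)) else 0)"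
      unfolding cscalar_prod_eq_sum[OF v v] by (intro sum.cong) (auto simp: v_def)
    also have "\<dots> = (\<Sum>s\<le>q. c * \<omega> ^ (i * f s) * cnj (c * \<omega> ^ (j * f s)))"
      using r by (intro sum.mono_neutral_cong_right) auto
    also have "\<dots> = (\<Sum>s\<le>q. (c * cnj c) * (\<omega> ^ i * cnj (\<omega> ^ j)) ^ f s)"
      by (intro sum.cong) (simp_all add: power_mult power_mult_distrib mult_ac)
    finally show ?thesis by (simp add: c sum_divide_distrib)
  qed
  have unit: "v i \<bullet>c v i = 1" for i
  proof -
    have "\<omega> ^ i * cnj (\<omega> ^ i) = 1"
      using norm_\<omega>[of i] by (simp only: complex_norm_square[symmetric]) simp
    moreover have "1 + complex_of_nat q \<noteq> 0"
      by (metis nat.distinct(1) of_nat_Suc of_nat_eq_0_iff)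
    ultimately show ?thesis unfolding ip by (simp add: add.commute)
  qed
  have angle: "cmod (v i \<bullet>c v j) = sqrt (real q) / (real q + 1)" if ij: "i < N" "j < N" "i \<noteq> j" for i j
  proof -
    define w where "w = \<omega> ^ i * cnj (\<omega> ^ j)"
    have "w ^ N = (\<omega> ^ N) ^ i * cnj ((\<omega> ^ N) ^ j)"
      by (simp add: w_def power_mult_distrib mult.commute flip: power_mult)
    then have w1: "w ^ N = 1" using \<omega> by simp
    have "w \<noteq> 1"
    proof
      assume "w = 1"
      moreover have "\<omega> ^ j * cnj (\<omega> ^ j) = 1"
        using norm_\<omega>[of j] by (simp only: complex_norm_square[symmetric]) simp
      moreover have "w * \<omega> ^ j = \<omega> ^ i * (\<omega> ^ j * cnj (\<omega> ^ j))" by (simp add: w_def)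
      ultimately have "\<omega> ^ i = \<omega> ^ j" by (simp only: mult_1 mult_1_right)
      then show False using cis_root_of_unity_power_inj[OF ij(1,2)] ij(3) unfolding \<omega>_def by simp
    qed
    moreover have "cmod w = 1" using norm_\<omega> by (simp add: w_def norm_mult del: complex_cnj_power)
    ultimately have "(\<Sum>s\<le>q. w ^ f s) * cnj (\<Sum>s\<le>q. w ^ f s) = of_nat q"
      by (intro modular_sidon_character_sum[OF N_def _ w1]) (rule f; assumption)
    then have "complex_of_real ((cmod (\<Sum>s\<le>q. w ^ f s))\<^sup>2) = of_real (real q)"
      by (simp only: complex_norm_square of_real_of_nat_eq)
    then have "(cmod (\<Sum>s\<le>q. w ^ f s))\<^sup>2 = real q"
      by (simp only: of_real_eq_iff)
    then have "cmod (\<Sum>s\<le>q. w ^ f s) = sqrt (real q)"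
      by (intro real_sqrt_unique[symmetric]) auto
    moreover have "cmod (of_nat q + 1) = real q + 1"
      using norm_of_nat[of "q + 1", where 'a = complex] by (simp add: add.commute)
    ultimately show ?thesis unfolding ip w_def[symmetric] by (simp add: norm_divide)
  qed
  have nz: "v i \<noteq> 0\<^sub>v r" for i
    using unit[of i] v[of i] by auto
  show ?thesis
    unfolding complex_equiangular_def N_def[symmetric]
  proof (intro exI conjI allI impI)
    show "complex_line r {d \<cdot>\<^sub>v v i | d. True}" for i
      by (rule complex_line_span[OF v nz])
    show "v i \<in> {d \<cdot>\<^sub>v v i | d. True}" for i
      by (rule CollectI, rule exI[of _ 1]) simp
  qed (use unit angle in auto)
qed

section \<open>The spectrum of a Hermitian matrix\<close>

definition mtrace :: "'a::semiring_0 mat \<Rightarrow> 'a" where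
  "mtrace A = (\<Sum>i<dim_row A. A $$ (i, i))"

lemma mtrace_mult:
  assumes "A \<in> carrier_mat m n" "B \<in> carrier_mat n m"
  shows "mtrace (A * B) = (\<Sum>i<m. \<Sum>j<n. A $$ (i, j) * B $$ (j, i))"
  using assms by (auto simp: mtrace_def scalar_prod_def atLeast0LessThan intro!: sum.cong)

lemma mtrace_comm:
  fixes A B :: "'a::comm_semiring_0 mat"
  assumes "A \<in> carrier_mat m n" "B \<in> carrier_mat n m"
  shows "mtrace (A * B) = mtrace (B * A)"
  unfolding mtrace_mult[OF assms] mtrace_mult[OF assms(2,1)]
  by (subst sum.swap) (simp add: mult.commute)

lemma mtrace_similar:
  fixes A B :: "'a::comm_ring_1 mat"
  assumes "similar_mat_wit A B P Q" "A \<in> carrier_mat n n"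
  shows "mtrace A = mtrace B"
proof -
  note w = similar_mat_witD2[OF assms(2,1)]
  have "mtrace A = mtrace (Q * (P * B))"
    using w(3,5-7) mtrace_comm[of "P * B" n n Q] by simp
  also have "Q * (P * B) = B"
    using w(2,5-7) assoc_mult_mat[of Q n n P n B n, symmetric] by simp
  finally show ?thesis .
qed

text \<open>With the same pair \<open>P\<close>, \<open>Q\<close> for both factors, a triangular
  form of a matrix also yields triangular forms of its powers.\<close>

lemma similar_mat_wit_mult:
  fixes A B :: "'a::comm_ring_1 mat"
  assumes "similar_mat_wit A B P Q" "similar_mat_wit A' B' P Q" "A \<in> carrier_mat n n" "A' \<in> carrier_mat n n"
  shows "similar_mat_wit (A * A') (B * B') P Q"
proof -
  note w = similar_mat_witD2[OF assms(3,1)] and w' = similar_mat_witD2[OF assms(4,2)]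
  have "A * A' = P * B * (Q * (P * (B' * Q)))"
    unfolding w(3) w'(3) using w(5-7) w'(5) by (simp add: assoc_mult_mat[of _ n n _ n _ n])
  also have "Q * (P * (B' * Q)) = B' * Q"
    using w(2,5-7) w'(5) assoc_mult_mat[of Q n n P n "B' * Q" n, symmetric] by simp
  also have "P * B * (B' * Q) = P * (B * B') * Q"
    using w(5-7) w'(5) by (simp add: assoc_mult_mat[of _ n n _ n _ n])
  finally show ?thesis
    using w(1,2,4-7) w'(4,5) by (intro similar_mat_witI[of _ _ n]) auto
qed

lemma upper_triangular_mult:
  fixes A B :: "'a::semiring_0 mat"
  assumes A: "A \<in> carrier_mat n n" "upper_triangular A" and B: "B \<in> carrier_mat n n" "upper_triangular B"
  shows "upper_triangular (A * B)" "\<And>i. i < n \<Longrightarrow> (A * B) $$ (i, i) = A $$ (i, i) * B $$ (i, i)"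
proof -
  have ix: "(A * B) $$ (i, j) = (\<Sum>k<n. A $$ (i, k) * B $$ (k, j))" if "i < n" "j < n" for i j
    using that A(1) B(1) by (simp add: scalar_prod_def atLeast0LessThan)
  have zero: "A $$ (i, k) * B $$ (k, j) = 0" if "i < n" "k < n" "k < i \<or> j < k" for i j k
    using that(3)
  proof
    assume "k < i"
    then show ?thesis using upper_triangularD[OF A(2)] A(1) that(1) by simp
  next
    assume "j < k"
    then show ?thesis using upper_triangularD[OF B(2)] B(1) that(2) by simp
  qed
  show "upper_triangular (A * B)"
  proof (rule upper_triangularI)
    fix i j assume ij: "j < i" "i < dim_row (A * B)"
    then have "i < n" using A(1) by simp
    have "(\<Sum>k<n. A $$ (i, k) * B $$ (k, j)) = 0"
    proof (rule sum.neutral, rule ballI)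
      fix k assume "k \<in> {..<n}"
      then show "A $$ (i, k) * B $$ (k, j) = 0"
        using ij \<open>i < n\<close> by (intro zero) auto
    qed
    then show "(A * B) $$ (i, j) = 0" using ix \<open>i < n\<close> ij by simp
  qed
  fix i assume i: "i < n"
  have "(\<Sum>k<n. A $$ (i, k) * B $$ (k, i)) = (\<Sum>k<n. if k = i then A $$ (i, i) * B $$ (i, i) else 0)"
  proof (intro sum.cong)
    fix k assume "k \<in> {..<n}"
    then show "A $$ (i, k) * B $$ (k, i) = (if k = i then A $$ (i, i) * B $$ (i, i) else 0)"
      using zero[of i k i] i by (cases "k = i") (auto simp: neq_iff)
  qed simp
  then show "(A * B) $$ (i, i) = A $$ (i, i) * B $$ (i, i)" using ix[OF i i] i by simp
qed

text \<open>The spectral argument uses only the power sums of orders 1, 2 and 4. These are traces,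
  read off the diagonals of a Schur triangular form and of its powers.\<close>

lemma hermitian_spectrum:
  fixes S :: "complex mat"
  assumes S: "S \<in> carrier_mat r r"
    and herm: "\<And>a b. a < r \<Longrightarrow> b < r \<Longrightarrow> S $$ (a, b) = cnj (S $$ (b, a))"
  shows "\<exists>d :: nat \<Rightarrow> real. mtrace S = of_real (\<Sum>i<r. d i) \<and> mtrace (S * S) = of_real (\<Sum>i<r. d i ^ 2) \<and>
    mtrace (S * S * (S * S)) = of_real (\<Sum>i<r. d i ^ 4) \<and> (\<forall>i<r. eigenvalue S (of_real (d i)))"
proof -
  obtain es where es: "char_poly S = (\<Prod>a\<leftarrow>es. [:- a, 1:])"
    using char_poly_factorized[OF S] by blast
  then obtain T where T: "T \<in> carrier_mat r r" "upper_triangular T" "similar_mat S T"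
    using schur_decomposition_exists[OF S] by blast
  then obtain P Q where PQ: "similar_mat_wit S T P Q" unfolding similar_mat_def by blast
  note PQ2 = similar_mat_wit_mult[OF PQ PQ S S]
  note PQ4 = similar_mat_wit_mult[OF PQ2 PQ2 mult_carrier_mat[OF S S] mult_carrier_mat[OF S S]]
  define z where "z i = T $$ (i, i)" for i
  have eig: "eigenvalue S (z i)" if "i < r" for i
  proof -
    have "char_poly S = char_poly T" by (rule char_poly_similar[OF T(3)])
    also have "\<dots> = (\<Prod>a\<leftarrow>diag_mat T. [:- a, 1:])" by (rule char_poly_upper_triangular[OF T(1,2)])
    finally have "poly (char_poly S) (z i) = (\<Prod>a\<leftarrow>diag_mat T. z i - a)"
      by (simp add: poly_prod_list o_def)
    moreover have "z i \<in> set (diag_mat T)" using that T(1) by (auto simp: diag_mat_def z_def)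
    ultimately have "poly (char_poly S) (z i) = 0" by (auto simp: prod_list_zero_iff)
    then show ?thesis by (simp add: eigenvalue_root_char_poly[OF S])
  qed
  have real: "z i = of_real (Re (z i))" if i: "i < r" for i
  proof -
    obtain u where u: "u \<in> carrier_vec r" "u \<noteq> 0\<^sub>v r" "S *\<^sub>v u = z i \<cdot>\<^sub>v u"
      using eig[OF i] S unfolding eigenvalue_def eigenvector_def by auto
    have Su: "(\<Sum>b<r. S $$ (a, b) * u $ b) = z i * u $ a" if "a < r" for a
    proof -
      have "(S *\<^sub>v u) $ a = (\<Sum>b<r. S $$ (a, b) * u $ b)"
        using that S u(1) by (simp add: scalar_prod_def atLeast0LessThan)
      then show ?thesis using u(1,3) that by simp
    qed
    \<comment> \<open>The squared norm of \<open>u\<close>; computing the quadratic form of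
      \<open>S\<close> at \<open>u\<close> in two ways shows that \<open>z i\<close> is
      real.\<close>
    define Z where "Z = (\<Sum>a<r. u $ a * cnj (u $ a))"
    have herm': "cnj (S $$ (b, a)) = S $$ (a, b)" if "a < r" "b < r" for a b
      using herm[OF that] by simp
    have "z i * Z = (\<Sum>a<r. \<Sum>b<r. S $$ (a, b) * u $ b * cnj (u $ a))"
      unfolding Z_def sum_distrib_left
    proof (rule sum.cong)
      fix a assume "a \<in> {..<r}"
      then show "z i * (u $ a * cnj (u $ a)) = (\<Sum>b<r. S $$ (a, b) * u $ b * cnj (u $ a))"
        using Su[of a] by (simp flip: sum_distrib_right)
    qed simp
    also have "\<dots> = (\<Sum>b<r. \<Sum>a<r. cnj (S $$ (b, a) * u $ a) * u $ b)"
      by (subst sum.swap) (intro sum.cong refl, simp add: herm' mult_ac)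
    also have "\<dots> = cnj (z i) * Z"
      unfolding Z_def sum_distrib_left
    proof (rule sum.cong)
      fix b assume "b \<in> {..<r}"
      then have "cnj (\<Sum>a<r. S $$ (b, a) * u $ a) * u $ b = cnj (z i * u $ b) * u $ b"
        using Su[of b] by (simp only: lessThan_iff)
      then have "(\<Sum>a<r. cnj (S $$ (b, a) * u $ a) * u $ b) = cnj (z i * u $ b) * u $ b"
        by (simp only: cnj_sum sum_distrib_right)
      then show "(\<Sum>a<r. cnj (S $$ (b, a) * u $ a) * u $ b) = cnj (z i) * (u $ b * cnj (u $ b))"
        by (simp only: complex_cnj_mult mult_ac)
    qed simp
    finally have "z i * Z = cnj (z i) * Z" .
    moreover have "Z \<noteq> 0"
    proof -
      have "Z = u \<bullet>c u" unfolding Z_def using cscalar_prod_eq_sum[OF u(1) u(1)] by simp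
      then show ?thesis using u(1,2) by (simp add: conjugate_square_eq_0_vec)
    qed
    ultimately have "z i = cnj (z i)" by simp
    then show ?thesis by (simp add: complex_eq_iff)
  qed
  note T2 = upper_triangular_mult[OF T(1,2) T(1,2)] and T2c = mult_carrier_mat[OF T(1) T(1)]
  note T4 = upper_triangular_mult(2)[OF T2c T2(1) T2c T2(1)]
  define d where "d i = Re (z i)" for i
  have dz: "T $$ (i, i) = of_real (d i)" if "i < r" for i using real that by (simp add: d_def z_def)
  have "mtrace S = of_real (\<Sum>i<r. d i)"
    unfolding mtrace_similar[OF PQ S] using T(1) dz by (simp add: mtrace_def)
  moreover have "mtrace (S * S) = of_real (\<Sum>i<r. d i ^ 2)"
    unfolding mtrace_similar[OF PQ2 mult_carrier_mat[OF S S]] using T(1) T2(2) dz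
    by (simp add: mtrace_def power2_eq_square del: index_mult_mat(1))
  moreover have "mtrace (S * S * (S * S)) = of_real (\<Sum>i<r. d i ^ 4)"
    unfolding mtrace_similar[OF PQ4 mult_carrier_mat[OF mult_carrier_mat[OF S S] mult_carrier_mat[OF S S]]]
    using T(1) T2(2) T4 dz
    by (simp add: mtrace_def power4_eq_xxxx mult.assoc del: index_mult_mat(1))
  moreover have "\<forall>i<r. eigenvalue S (of_real (d i))"
    using eig dz by (simp add: z_def)
  ultimately show ?thesis by blast
qed

section \<open>The projection method\<close>

text \<open>The projection of \<open>X\<close> onto the span of the \<open>P k\<close> is \<open>Y = (\<Sum>k. y k * P k)\<close>, where the
  coefficient vector \<open>y\<close> comes from the explicit inverse of the Gram matrix \<open>(1 - \<beta>) I + \<beta> J\<close>.\<close>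
lemma equiangular_bessel:
  fixes P :: "nat \<Rightarrow> 'i \<Rightarrow> complex" and X :: "'i \<Rightarrow> complex"
  assumes I: "finite I" and \<beta>: "0 \<le> \<beta>" "\<beta> < 1"
    and gram: "\<And>k l. k < n \<Longrightarrow> l < n \<Longrightarrow>
      (\<Sum>i\<in>I. P k i * cnj (P l i)) = of_real (if k = l then 1 else \<beta>)"
  defines "b \<equiv> 1 - \<beta> + \<beta> * real n" and "x \<equiv> \<lambda>k. \<Sum>i\<in>I. X i * cnj (P k i)"
  shows "(\<Sum>k<n. (cmod (x k))\<^sup>2) \<le>
    (1 - \<beta>) * (\<Sum>i\<in>I. (cmod (X i))\<^sup>2) + \<beta> / b * (cmod (\<Sum>k<n. x k))\<^sup>2"
proof -
  have b: "b > 0" using \<beta> by (auto simp: b_def intro: add_pos_nonneg)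
  define s where "s = (\<Sum>k<n. x k)"
  \<comment> \<open>The inverse of the Gram matrix is
    \<open>(I - (\<beta> / b) J) / (1 - \<beta>)\<close>, where \<open>b\<close> is the eigenvalue
    at the all-ones vector.\<close>
  define y where "y k = (x k - of_real (\<beta> / b) * s) / of_real (1 - \<beta>)" for k
  define Y where "Y i = (\<Sum>k<n. y k * P k i)" for i
  \<comment> \<open>Since \<open>Y\<close> is the projection of \<open>X\<close>, the inner products
    of \<open>Y\<close> with \<open>X\<close> and with itself agree; \<open>R\<close> is this common
    value, and the squared norm of \<open>X - Y\<close> is that of \<open>X\<close> minus
    \<open>R\<close>.\<close>
  define R where "R = ((\<Sum>k<n. (cmod (x k))\<^sup>2) - \<beta> / b * (cmod s)\<^sup>2) / (1 - \<beta>)"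
  have sq: "z * cnj z = of_real ((cmod z)\<^sup>2)" for z
    by (simp only: complex_norm_square)
  have sum_x: "(\<Sum>k<n. x k * cnj (x k)) = of_real (\<Sum>k<n. (cmod (x k))\<^sup>2)"
    by (simp only: sq of_real_sum)
  have XY: "(\<Sum>i\<in>I. X i * cnj (Y i)) = of_real R"
  proof -
    have "(\<Sum>i\<in>I. X i * cnj (Y i)) = (\<Sum>k<n. \<Sum>i\<in>I. cnj (y k) * (X i * cnj (P k i)))"
      unfolding Y_def cnj_sum sum_distrib_left
      by (subst sum.swap) (simp add: mult_ac)
    also have "\<dots> = (\<Sum>k<n. cnj (y k) * x k)" by (simp add: x_def sum_distrib_left)
    also have "\<dots> = (\<Sum>k<n. x k * cnj (x k) - of_real (\<beta> / b) * cnj s * x k) / of_real (1 - \<beta>)"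
      unfolding sum_divide_distrib by (intro sum.cong) (simp_all add: y_def algebra_simps diff_divide_distrib)
    also have "(\<Sum>k<n. x k * cnj (x k) - of_real (\<beta> / b) * cnj s * x k) =
        of_real (\<Sum>k<n. (cmod (x k))\<^sup>2) - of_real (\<beta> / b) * (s * cnj s)"
    proof -
      have "(\<Sum>k<n. of_real (\<beta> / b) * cnj s * x k) = of_real (\<beta> / b) * cnj s * s"
        by (simp only: s_def sum_distrib_left)
      then show ?thesis unfolding sum_subtractf sum_x by simp
    qed
    also have "\<dots> / of_real (1 - \<beta>) = of_real R"
      unfolding sq R_def by simp
    finally show ?thesis .
  qed
  have sum_y: "(\<Sum>k<n. y k) = s / of_real b"
  proof -
    have "(\<Sum>k<n. y k) = (s - of_nat n * (of_real (\<beta> / b) * s)) / of_real (1 - \<beta>)"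
      unfolding y_def by (simp add: s_def sum_subtractf flip: sum_divide_distrib)
    also have "\<dots> = s * of_real ((1 - real n * \<beta> / b) / (1 - \<beta>))"
      by (simp add: algebra_simps)
    also have "(1 - real n * \<beta> / b) / (1 - \<beta>) = 1 / b"
      using b \<beta> by (simp add: field_simps) (simp add: b_def algebra_simps)
    finally show ?thesis by (simp add: divide_inverse)
  qed
  have YY: "(\<Sum>i\<in>I. Y i * cnj (Y i)) = of_real R"
  proof -
    have "(\<Sum>i\<in>I. Y i * cnj (Y i)) =
        (\<Sum>i\<in>I. \<Sum>k<n. \<Sum>l<n. y k * cnj (y l) * (P k i * cnj (P l i)))"
      unfolding Y_def cnj_sum sum_product by (simp add: mult_ac)
    also have "\<dots> = (\<Sum>k<n. \<Sum>l<n. y k * cnj (y l) * (\<Sum>i\<in>I. P k i * cnj (P l i)))"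
      unfolding sum_distrib_left
      by (subst sum.swap, rule sum.cong, rule refl, rule sum.swap)
    also have "\<dots> = (\<Sum>k<n. \<Sum>l<n. y k * cnj (y l) * of_real (if k = l then 1 else \<beta>))"
      by (intro sum.cong refl) (simp add: gram)
    also have "\<dots> = (\<Sum>k<n. \<Sum>l<n. (if l = k then of_real (1 - \<beta>) * (y k * cnj (y k)) else 0)
        + of_real \<beta> * (y k * cnj (y l)))"
      by (intro sum.cong refl) (auto simp: algebra_simps)
    also have "\<dots> = of_real (1 - \<beta>) * (\<Sum>k<n. y k * cnj (y k))
        + of_real \<beta> * ((\<Sum>k<n. y k) * cnj (\<Sum>k<n. y k))"
    proof -
      have "(\<Sum>k<n. \<Sum>l<n. if l = k then of_real (1 - \<beta>) * (y k * cnj (y k)) else 0) =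
          of_real (1 - \<beta>) * (\<Sum>k<n. y k * cnj (y k))"
        by (simp add: sum_distrib_left)
      moreover have "(\<Sum>k<n. \<Sum>l<n. of_real \<beta> * (y k * cnj (y l))) =
          of_real \<beta> * ((\<Sum>k<n. y k) * cnj (\<Sum>k<n. y k))"
        by (simp only: sum_product cnj_sum sum_distrib_left[symmetric])
      ultimately show ?thesis by (simp only: sum.distrib)
    qed
    also have "(\<Sum>k<n. y k * cnj (y k)) =
        (\<Sum>k<n. x k * cnj (x k) - of_real (\<beta> / b) * (cnj s * x k + s * cnj (x k))
          + of_real ((\<beta> / b)\<^sup>2) * (s * cnj s)) / of_real ((1 - \<beta>)\<^sup>2)"
      unfolding sum_divide_distrib
      by (intro sum.cong refl) (simp add: y_def algebra_simps power2_eq_square diff_divide_distrib add_divide_distrib)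
    also have "(\<Sum>k<n. x k * cnj (x k) - of_real (\<beta> / b) * (cnj s * x k + s * cnj (x k))
          + of_real ((\<beta> / b)\<^sup>2) * (s * cnj s)) =
        of_real ((\<Sum>k<n. (cmod (x k))\<^sup>2) - 2 * (\<beta> / b) * (cmod s)\<^sup>2 + real n * (\<beta> / b)\<^sup>2 * (cmod s)\<^sup>2)"
    proof -
      have lin: "(\<Sum>k<n. x k * cnj (x k) - a * f k + c) =
          of_real (\<Sum>k<n. (cmod (x k))\<^sup>2) - a * (\<Sum>k<n. f k) + of_nat n * c" for a c f
        unfolding sum.distrib sum_subtractf sum_x sum_distrib_left by simp
      have "(\<Sum>k<n. cnj s * x k + s * cnj (x k)) = cnj s * s + s * cnj s"
        unfolding sum.distrib sum_distrib_left[symmetric] cnj_sum[symmetric] s_def ..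
      then have two: "(\<Sum>k<n. cnj s * x k + s * cnj (x k)) = 2 * (s * cnj s)"
        by (simp only: mult.commute mult_2)
      show ?thesis unfolding lin unfolding two sq by simp
    qed
    also have "(\<Sum>k<n. y k) * cnj (\<Sum>k<n. y k) = of_real ((cmod s)\<^sup>2 / b\<^sup>2)"
      unfolding sq sum_y using b by (simp add: norm_divide power_divide)
    also have "of_real (1 - \<beta>) * (of_real ((\<Sum>k<n. (cmod (x k))\<^sup>2) - 2 * (\<beta> / b) * (cmod s)\<^sup>2
          + real n * (\<beta> / b)\<^sup>2 * (cmod s)\<^sup>2) / of_real ((1 - \<beta>)\<^sup>2))
        + of_real \<beta> * complex_of_real ((cmod s)\<^sup>2 / b\<^sup>2) = of_real R"
    proof -
      define T q where "T = (\<Sum>k<n. (cmod (x k))\<^sup>2)" and "q = (cmod s)\<^sup>2"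
      have nb: "real n * \<beta> = b - (1 - \<beta>)" by (simp add: b_def)
      have "real n * (\<beta> / b)\<^sup>2 * q = (real n * \<beta>) * \<beta> * q / b\<^sup>2"
        by (simp add: power2_eq_square)
      also have "\<dots> = \<beta> / b * q - (1 - \<beta>) * \<beta> * q / b\<^sup>2"
        unfolding nb using b by (simp add: field_simps power2_eq_square)
      finally have nq: "real n * (\<beta> / b)\<^sup>2 * q = \<beta> / b * q - (1 - \<beta>) * \<beta> * q / b\<^sup>2" .
      have one: "(1 - \<beta>) * (t / (1 - \<beta>)\<^sup>2) = t / (1 - \<beta>)" for t
        using \<beta> by (simp add: power2_eq_square)
      have "(1 - \<beta>) * ((T - 2 * (\<beta> / b) * q + real n * (\<beta> / b)\<^sup>2 * q) / (1 - \<beta>)\<^sup>2) + \<beta> * (q / b\<^sup>2)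
          = (T - \<beta> / b * q) / (1 - \<beta>)"
        unfolding one nq using \<beta> by (simp add: field_simps)
      then show ?thesis
        unfolding R_def T_def[symmetric] q_def[symmetric]
        by (simp only: of_real_mult[symmetric] of_real_divide[symmetric] of_real_add[symmetric])
    qed
    finally show ?thesis .
  qed
  have "of_real (\<Sum>i\<in>I. (cmod (X i - Y i))\<^sup>2) = (\<Sum>i\<in>I. (X i - Y i) * cnj (X i - Y i))"
    by (simp only: sq of_real_sum)
  also have "\<dots> = (\<Sum>i\<in>I. X i * cnj (X i) - X i * cnj (Y i) - cnj (X i * cnj (Y i)) + Y i * cnj (Y i))"
    by (simp add: algebra_simps)
  also have "\<dots> = (\<Sum>i\<in>I. X i * cnj (X i)) - (\<Sum>i\<in>I. X i * cnj (Y i))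
      - cnj (\<Sum>i\<in>I. X i * cnj (Y i)) + (\<Sum>i\<in>I. Y i * cnj (Y i))"
    by (simp only: sum.distrib sum_subtractf cnj_sum)
  also have "\<dots> = of_real ((\<Sum>i\<in>I. (cmod (X i))\<^sup>2) - R)"
    unfolding XY YY by (simp only: sq of_real_sum[symmetric]) simp
  finally have "(\<Sum>i\<in>I. (cmod (X i - Y i))\<^sup>2) = (\<Sum>i\<in>I. (cmod (X i))\<^sup>2) - R"
    by (simp only: of_real_eq_iff)
  moreover have "(\<Sum>i\<in>I. (cmod (X i - Y i))\<^sup>2) \<ge> 0" by (simp add: sum_nonneg)
  ultimately have "R \<le> (\<Sum>i\<in>I. (cmod (X i))\<^sup>2)" by simp
  then show ?thesis
    unfolding R_def s_def[symmetric] using \<beta> by (simp add: pos_divide_le_eq mult.commute)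
qed

text \<open>Cauchy-Schwarz, from the nonnegative variance of \<open>f\<close> about its
  mean.\<close>

lemma sum_squared_le_card_mult:
  fixes f :: "'a \<Rightarrow> real"
  assumes "finite I"
  shows "(\<Sum>i\<in>I. f i)\<^sup>2 \<le> real (card I) * (\<Sum>i\<in>I. (f i)\<^sup>2)"
proof (cases "I = {}")
  case False
  define c s t where "c = real (card I)" and "s = (\<Sum>i\<in>I. f i)" and "t = s / c"
  have c: "c > 0" using False assms by (simp add: c_def card_gt_0_iff)
  have "0 \<le> (\<Sum>i\<in>I. (f i - t)\<^sup>2)" by (simp add: sum_nonneg)
  also have "\<dots> = (\<Sum>i\<in>I. (f i)\<^sup>2 - 2 * t * f i + t\<^sup>2)"
    by (simp add: power2_diff algebra_simps)
  also have "\<dots> = (\<Sum>i\<in>I. (f i)\<^sup>2) - 2 * t * s + c * t\<^sup>2"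
    by (simp add: sum.distrib sum_subtractf c_def s_def sum_distrib_left)
  also have "\<dots> = (\<Sum>i\<in>I. (f i)\<^sup>2) - s\<^sup>2 / c"
    using c by (simp add: t_def power2_eq_square)
  finally have "s\<^sup>2 \<le> c * (\<Sum>i\<in>I. (f i)\<^sup>2)"
    using c by (simp add: pos_divide_le_eq mult.commute)
  then show ?thesis by (simp only: c_def s_def)
qed simp

lemma cscalar_prod_swap:
  fixes v w :: "complex vec"
  assumes "v \<in> carrier_vec r" "w \<in> carrier_vec r"
  shows "w \<bullet>c v = cnj (v \<bullet>c w)"
  by (simp add: cscalar_prod_eq_sum[OF assms] cscalar_prod_eq_sum[OF assms(2,1)] mult.commute)

lemma cscalar_prod_self:
  assumes "v \<in> carrier_vec r"
  shows "v \<bullet>c v = of_real (\<Sum>a<r. (cmod (v $ a))\<^sup>2)"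
  by (simp only: cscalar_prod_eq_sum[OF assms assms] of_real_sum complex_norm_square)

section \<open>Moment bounds for an equiangular system\<close>

locale equiangular_vectors =
  fixes v :: "nat \<Rightarrow> complex vec" and n r :: nat and \<alpha> :: real
  assumes v: "i < n \<Longrightarrow> v i \<in> carrier_vec r"
    and unit: "i < n \<Longrightarrow> v i \<bullet>c v i = 1"
    and angle: "i < n \<Longrightarrow> j < n \<Longrightarrow> i \<noteq> j \<Longrightarrow> cmod (v i \<bullet>c v j) = \<alpha>"
    and \<alpha>: "0 < \<alpha>" "\<alpha> < 1"
begin

text \<open>The row sum of the Gram matrix of the rank-one projections, and the diagonal entry of
  the squared Gram matrix of the vectors (\<open>m_diag\<close>).\<close>

definition b where "b = 1 - \<alpha>\<^sup>2 + \<alpha>\<^sup>2 * real n"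

lemma \<alpha>_sq: "\<alpha>\<^sup>2 < 1"
  using \<alpha> by (simp add: power_less_one_iff)

lemma b_pos: "b > 0"
  using \<alpha>_sq by (auto simp: b_def intro: add_pos_nonneg)

lemma norm_ip: "i < n \<Longrightarrow> j < n \<Longrightarrow> cmod (v i \<bullet>c v j) = (if i = j then 1 else \<alpha>)"
  using unit angle by auto

lemma ip_swap: "i < n \<Longrightarrow> j < n \<Longrightarrow> v j \<bullet>c v i = cnj (v i \<bullet>c v j)"
  by (rule cscalar_prod_swap[OF v v])

text \<open>\<open>equiangular_bessel\<close> for matrices as functions on index pairs:
  \<open>X\<close> is \<open>w\<close> times the adjoint of \<open>z\<close>, and \<open>P k\<close>
  is \<open>v k\<close> times its own adjoint. Frobenius inner products of such matrices factor into
  inner products of vectors, so \<open>\<beta>\<close> becomes \<open>\<alpha>^2\<close>.\<close>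

lemma rank_one_bound:
  assumes w: "w \<in> carrier_vec r" and z: "z \<in> carrier_vec r"
  shows "(\<Sum>k<n. (cmod (w \<bullet>c v k))\<^sup>2 * (cmod (v k \<bullet>c z))\<^sup>2) \<le>
    (1 - \<alpha>\<^sup>2) * (cmod (w \<bullet>c w) * cmod (z \<bullet>c z)) +
    \<alpha>\<^sup>2 / b * (cmod (\<Sum>k<n. (w \<bullet>c v k) * (v k \<bullet>c z)))\<^sup>2"
proof -
  define I where "I = {..<r} \<times> {..<r}"
  define P where "P k = (\<lambda>(a, c). v k $ a * cnj (v k $ c))" for k
  define X where "X = (\<lambda>(a, c). w $ a * cnj (z $ c))"
  have gram: "(\<Sum>i\<in>I. P k i * cnj (P l i)) = of_real (if k = l then 1 else \<alpha>\<^sup>2)"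
    if kl: "k < n" "l < n" for k l
  proof -
    have "(\<Sum>i\<in>I. P k i * cnj (P l i)) =
        (\<Sum>a<r. \<Sum>c<r. (v k $ a * cnj (v l $ a)) * (v l $ c * cnj (v k $ c)))"
      unfolding I_def P_def sum.cartesian_product by (simp add: split_def mult_ac)
    also have "\<dots> = (v k \<bullet>c v l) * (v l \<bullet>c v k)"
      by (simp only: cscalar_prod_eq_sum[OF v[OF kl(1)] v[OF kl(2)]]
          cscalar_prod_eq_sum[OF v[OF kl(2)] v[OF kl(1)]] sum_product)
    also have "\<dots> = of_real ((cmod (v k \<bullet>c v l))\<^sup>2)"
      unfolding ip_swap[OF kl] by (simp only: complex_norm_square)
    finally show ?thesis using norm_ip[OF kl] by simp
  qed
  have x: "(\<Sum>i\<in>I. X i * cnj (P k i)) = (w \<bullet>c v k) * (v k \<bullet>c z)" if "k < n" for k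
  proof -
    have "(\<Sum>i\<in>I. X i * cnj (P k i)) =
        (\<Sum>a<r. \<Sum>c<r. (w $ a * cnj (v k $ a)) * (v k $ c * cnj (z $ c)))"
      unfolding I_def P_def X_def sum.cartesian_product by (simp add: split_def mult_ac)
    then show ?thesis
      by (simp only: cscalar_prod_eq_sum[OF w v[OF that]] cscalar_prod_eq_sum[OF v[OF that] z] sum_product)
  qed
  have X: "(\<Sum>i\<in>I. (cmod (X i))\<^sup>2) = cmod (w \<bullet>c w) * cmod (z \<bullet>c z)"
  proof -
    have "(\<Sum>i\<in>I. (cmod (X i))\<^sup>2) = (\<Sum>a<r. \<Sum>c<r. (cmod (w $ a))\<^sup>2 * (cmod (z $ c))\<^sup>2)"
      unfolding I_def X_def sum.cartesian_product
      by (simp add: split_def norm_mult power_mult_distrib)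
    also have "\<dots> = (\<Sum>a<r. (cmod (w $ a))\<^sup>2) * (\<Sum>c<r. (cmod (z $ c))\<^sup>2)"
      by (simp only: sum_product)
    also have "\<dots> = cmod (w \<bullet>c w) * cmod (z \<bullet>c z)"
      unfolding cscalar_prod_self[OF w] cscalar_prod_self[OF z] norm_of_real
      by (simp add: sum_nonneg)
    finally show ?thesis .
  qed
  have fin: "finite I" by (simp add: I_def)
  have "(\<Sum>k<n. (cmod (\<Sum>i\<in>I. X i * cnj (P k i)))\<^sup>2) \<le> (1 - \<alpha>\<^sup>2) * (\<Sum>i\<in>I. (cmod (X i))\<^sup>2)
      + \<alpha>\<^sup>2 / (1 - \<alpha>\<^sup>2 + \<alpha>\<^sup>2 * real n) * (cmod (\<Sum>k<n. \<Sum>i\<in>I. X i * cnj (P k i)))\<^sup>2"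
    by (rule equiangular_bessel[OF fin _ \<alpha>_sq gram]) simp_all
  moreover have "(\<Sum>k<n. (cmod (\<Sum>i\<in>I. X i * cnj (P k i)))\<^sup>2) =
      (\<Sum>k<n. (cmod (w \<bullet>c v k))\<^sup>2 * (cmod (v k \<bullet>c z))\<^sup>2)"
    by (intro sum.cong refl) (simp only: x lessThan_iff norm_mult power_mult_distrib)
  moreover have "(\<Sum>k<n. \<Sum>i\<in>I. X i * cnj (P k i)) = (\<Sum>k<n. (w \<bullet>c v k) * (v k \<bullet>c z))"
    by (intro sum.cong refl) (simp only: x lessThan_iff)
  ultimately show ?thesis by (simp only: X b_def)
qed

text \<open>Entry of the square of the Gram matrix of the vectors.\<close>

definition m where "m i j = (\<Sum>k<n. (v i \<bullet>c v k) * (v k \<bullet>c v j))"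

lemma m_swap: "i < n \<Longrightarrow> j < n \<Longrightarrow> m j i = cnj (m i j)"
  unfolding m_def cnj_sum complex_cnj_mult
  by (intro sum.cong refl) (simp add: ip_swap[symmetric] mult.commute)

lemma m_diag:
  assumes "i < n"
  shows "m i i = of_real b"
proof -
  have "m i i = (\<Sum>k<n. of_real ((cmod (v i \<bullet>c v k))\<^sup>2))"
    unfolding m_def by (intro sum.cong refl) (simp only: ip_swap[OF assms] complex_norm_square lessThan_iff)
  also have "\<dots> = of_real (\<Sum>k<n. if k = i then 1 else \<alpha>\<^sup>2)"
    unfolding of_real_sum by (intro sum.cong refl) (simp add: norm_ip assms)
  also have "(\<Sum>k<n. if k = i then 1 else \<alpha>\<^sup>2) = (\<Sum>k<n. (if k = i then 1 - \<alpha>\<^sup>2 else 0) + \<alpha>\<^sup>2)"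
    by (intro sum.cong) auto
  also have "\<dots> = b" using assms by (simp add: sum.distrib b_def mult.commute)
  finally show ?thesis .
qed

text \<open>For \<open>i \<noteq> j\<close> the left side of \<open>rank_one_bound\<close> at
  \<open>v i\<close>, \<open>v j\<close> is known exactly, and \<open>m i j\<close> occurs only on
  the right, so the upper bound turns into a lower bound for \<open>m i j\<close>.\<close>

lemma m_bound:
  assumes ij: "i < n" "j < n" and n: "real n * \<alpha> ^ 4 \<ge> 1"
  shows "real n * (real n * \<alpha> ^ 4 - 1) \<le> (cmod (m i j))\<^sup>2"
proof (cases "i = j")
  case True
  have "\<alpha>\<^sup>2 * real n \<le> b" using \<alpha>_sq by (simp add: b_def)
  then have "(\<alpha>\<^sup>2 * real n)\<^sup>2 \<le> b\<^sup>2" by (intro power_mono) auto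
  moreover have "real n * (real n * \<alpha> ^ 4 - 1) \<le> (\<alpha>\<^sup>2 * real n)\<^sup>2"
    by (simp add: power2_eq_square power4_eq_xxxx algebra_simps)
  ultimately show ?thesis using True m_diag[OF ij(1)] by simp
next
  case False
  \<comment> \<open>Every term is \<open>\<alpha>^4\<close>, except \<open>\<alpha>^2\<close> at
    \<open>k = i\<close> and at \<open>k = j\<close>.\<close>
  have "(\<Sum>k<n. (cmod (v i \<bullet>c v k))\<^sup>2 * (cmod (v k \<bullet>c v j))\<^sup>2) =
      (\<Sum>k<n. ((if k = i then \<alpha>\<^sup>2 - \<alpha> ^ 4 else 0) + (if k = j then \<alpha>\<^sup>2 - \<alpha> ^ 4 else 0)) + \<alpha> ^ 4)"
    using False by (intro sum.cong refl) (auto simp: norm_ip ij power_mult[symmetric] power2_eq_square power4_eq_xxxx)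
  also have "\<dots> = real n * \<alpha> ^ 4 + 2 * (\<alpha>\<^sup>2 - \<alpha> ^ 4)"
    using ij by (simp add: sum.distrib)
  finally have "real n * \<alpha> ^ 4 + 2 * (\<alpha>\<^sup>2 - \<alpha> ^ 4) \<le> (1 - \<alpha>\<^sup>2) + \<alpha>\<^sup>2 / b * (cmod (m i j))\<^sup>2"
    using rank_one_bound[OF v[OF ij(1)] v[OF ij(2)]] ij unit by (simp add: m_def)
  moreover have "\<alpha> ^ 4 \<le> \<alpha>\<^sup>2" using \<alpha> by (intro power_decreasing) auto
  ultimately have 1: "real n * \<alpha> ^ 4 - 1 \<le> \<alpha>\<^sup>2 / b * (cmod (m i j))\<^sup>2"
    using zero_le_power2[of \<alpha>] by (smt (verit))
  have "\<alpha>\<^sup>2 * real n \<le> b" using \<alpha>_sq by (simp add: b_def)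
  then have "\<alpha>\<^sup>2 * real n * (real n * \<alpha> ^ 4 - 1) \<le> b * (real n * \<alpha> ^ 4 - 1)"
    using n by (intro mult_right_mono) auto
  also have "\<dots> \<le> b * (\<alpha>\<^sup>2 / b * (cmod (m i j))\<^sup>2)"
    using 1 b_pos by (intro mult_left_mono) auto
  also have "\<dots> = \<alpha>\<^sup>2 * (cmod (m i j))\<^sup>2" using b_pos by simp
  finally show ?thesis using \<alpha> by (simp add: mult.assoc)
qed

section \<open>The frame operator and its spectrum\<close>

definition S :: "complex mat" where
  "S = mat r r (\<lambda>(a, c). \<Sum>k<n. v k $ a * cnj (v k $ c))"

lemma S_carrier: "S \<in> carrier_mat r r"
  by (simp add: S_def)

text \<open>\<open>S = B * C\<close> and the Gram matrix is \<open>M = C * B\<close>, so cyclicity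
  of the trace turns traces of powers of \<open>S\<close> into traces of powers of
  \<open>M\<close>.\<close>

lemma mtrace_S:
  "mtrace S = of_nat n" "mtrace (S * S) = of_real (real n * b)"
  "mtrace (S * S * (S * S)) = of_real (\<Sum>i<n. \<Sum>j<n. (cmod (m i j))\<^sup>2)"
proof -
  define B where "B = mat r n (\<lambda>(a, k). v k $ a)"
  define C where "C = mat n r (\<lambda>(k, a). cnj (v k $ a))"
  define M where "M = C * B"
  have B: "B \<in> carrier_mat r n" and C: "C \<in> carrier_mat n r" by (simp_all add: B_def C_def)
  have M: "M \<in> carrier_mat n n" using B C by (simp add: M_def)
  have S: "S = B * C"
    by (rule eq_matI) (auto simp: S_def B_def C_def scalar_prod_def atLeast0LessThan)
  have M_ix: "M $$ (i, j) = v j \<bullet>c v i" if "i < n" "j < n" for i j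
    unfolding M_def using that cscalar_prod_eq_sum[OF v[OF that(2)] v[OF that(1)]]
    by (simp add: B_def C_def scalar_prod_def atLeast0LessThan mult.commute)
  have MM: "(M * M) $$ (i, j) = m j i" if "i < n" "j < n" for i j
    using that M by (simp add: scalar_prod_def atLeast0LessThan M_ix m_def mult.commute)
  note MMc = mult_carrier_mat[OF M M]
  have "mtrace S = mtrace M" unfolding S M_def by (rule mtrace_comm[OF B C])
  also have "\<dots> = of_nat n" using M unit by (simp add: mtrace_def M_ix)
  finally show "mtrace S = of_nat n" .
  have SS: "S * S = B * (M * C)"
    unfolding S M_def using B C by (simp add: assoc_mult_mat[of _ _ _ _ _ _ r] assoc_mult_mat[of _ _ _ _ _ _ n])
  have "mtrace (S * S) = mtrace (M * C * B)"
    unfolding SS by (rule mtrace_comm[OF B mult_carrier_mat[OF M C]])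
  also have "M * C * B = M * M" unfolding M_def using B C by (intro assoc_mult_mat) auto
  also have "mtrace (M * M) = of_real (real n * b)"
    using M by (simp add: mtrace_def MM m_diag del: index_mult_mat(1))
  finally show "mtrace (S * S) = of_real (real n * b)" .
  have SSSS: "S * S * (S * S) = B * (M * (M * M) * C)"
  proof -
    have "S * S * (S * S) = B * (M * C * (B * (M * C)))"
      unfolding SS using B C M by (intro assoc_mult_mat) auto
    also have "M * C * (B * (M * C)) = M * (C * (B * (M * C)))"
      using B C M by (intro assoc_mult_mat) auto
    also have "C * (B * (M * C)) = M * (M * C)"
      unfolding M_def using B C by (intro assoc_mult_mat[symmetric]) auto
    also have "M * (M * C) = (M * M) * C"
      using C M by (intro assoc_mult_mat[symmetric]) auto
    also have "M * ((M * M) * C) = M * (M * M) * C"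
      using C M by (intro assoc_mult_mat[symmetric]) auto
    finally show ?thesis .
  qed
  have "mtrace (S * S * (S * S)) = mtrace (M * (M * M) * C * B)"
    unfolding SSSS by (rule mtrace_comm[OF B]) (use M C in auto)
  also have "M * (M * M) * C * B = M * (M * M) * M"
    unfolding M_def using B C by (intro assoc_mult_mat) auto
  also have "\<dots> = M * M * (M * M)"
    using M by (simp add: assoc_mult_mat[of _ n n _ n _ n])
  also have "mtrace (M * M * (M * M)) = (\<Sum>i<n. \<Sum>j<n. m j i * m i j)"
    unfolding mtrace_mult[OF MMc MMc] by (intro sum.cong refl) (simp add: MM del: index_mult_mat(1))
  also have "\<dots> = of_real (\<Sum>i<n. \<Sum>j<n. (cmod (m i j))\<^sup>2)"
    unfolding of_real_sum
  proof (intro sum.cong refl)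
    fix i j assume "i \<in> {..<n}" "j \<in> {..<n}"
    then have "m j i = cnj (m i j)" using m_swap[of i j] by simp
    then show "m j i * m i j = of_real ((cmod (m i j))\<^sup>2)"
      by (simp only: complex_norm_square mult.commute)
  qed
  finally show "mtrace (S * S * (S * S)) = of_real (\<Sum>i<n. \<Sum>j<n. (cmod (m i j))\<^sup>2)" .
qed

text \<open>In \<open>rank_one_bound\<close> for an eigenvector \<open>u\<close> and
  \<open>v j\<close>, the sum on the right collapses to \<open>\<mu>\<close> times the inner product
  of \<open>u\<close> and \<open>v j\<close>. Adding over \<open>j\<close>, where the squared inner
  products sum to \<open>\<mu>\<close> times the squared norm of \<open>u\<close>, gives the cubic
  inequality.\<close>

lemma S_eigenvalue:
  assumes "eigenvalue S (of_real \<mu>)"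
  shows "0 \<le> \<mu>" "b * \<mu> \<le> (1 - \<alpha>\<^sup>2) * real n + \<alpha>\<^sup>2 * \<mu> ^ 3 / b"
proof -
  obtain u where u: "u \<in> carrier_vec r" "u \<noteq> 0\<^sub>v r" "S *\<^sub>v u = of_real \<mu> \<cdot>\<^sub>v u"
    using assms S_carrier unfolding eigenvalue_def eigenvector_def by auto
  define g where "g k = u \<bullet>c v k" for k
  have Su: "(\<Sum>k<n. g k * v k $ a) = of_real \<mu> * u $ a" if a: "a < r" for a
  proof -
    have "(\<Sum>k<n. g k * v k $ a) = (\<Sum>k<n. \<Sum>c<r. v k $ a * cnj (v k $ c) * u $ c)"
      unfolding g_def by (intro sum.cong refl) (simp add: cscalar_prod_eq_sum[OF u(1) v] sum_distrib_left sum_distrib_right mult_ac)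
    also have "\<dots> = (\<Sum>c<r. (\<Sum>k<n. v k $ a * cnj (v k $ c)) * u $ c)"
      by (subst sum.swap) (simp add: sum_distrib_right)
    also have "\<dots> = (S *\<^sub>v u) $ a"
      using a u(1) by (simp add: S_def scalar_prod_def atLeast0LessThan)
    finally show ?thesis using u(1,3) a by simp
  qed
  have Su_ip: "(\<Sum>k<n. g k * (v k \<bullet>c z)) = of_real \<mu> * (u \<bullet>c z)" if z: "z \<in> carrier_vec r" for z
  proof -
    have "(\<Sum>k<n. g k * (v k \<bullet>c z)) = (\<Sum>k<n. \<Sum>a<r. g k * v k $ a * cnj (z $ a))"
      by (intro sum.cong refl) (simp add: cscalar_prod_eq_sum[OF v z] sum_distrib_left mult_ac)
    also have "\<dots> = (\<Sum>a<r. (\<Sum>k<n. g k * v k $ a) * cnj (z $ a))"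
      by (subst sum.swap) (simp add: sum_distrib_right)
    also have "\<dots> = (\<Sum>a<r. of_real \<mu> * (u $ a * cnj (z $ a)))"
      by (intro sum.cong refl) (simp add: Su)
    finally show ?thesis by (simp add: cscalar_prod_eq_sum[OF u(1) z] sum_distrib_left)
  qed
  define U where "U = (\<Sum>a<r. (cmod (u $ a))\<^sup>2)"
  have U: "u \<bullet>c u = of_real U" unfolding U_def by (rule cscalar_prod_self[OF u(1)])
  have "u \<bullet>c u \<noteq> 0" using u(1,2) by (simp add: conjugate_square_eq_0_vec)
  then have "U \<noteq> 0" unfolding U by simp
  then have U_pos: "U > 0" unfolding U_def using sum_nonneg[of "{..<r}" "\<lambda>a. (cmod (u $ a))\<^sup>2"] by simp
  have "of_real (\<Sum>k<n. (cmod (g k))\<^sup>2) = (\<Sum>k<n. g k * (v k \<bullet>c u))"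
    unfolding of_real_sum g_def
    by (intro sum.cong refl) (simp add: cscalar_prod_swap[OF u(1) v] complex_norm_square del: of_real_power)
  also have "\<dots> = of_real (\<mu> * U)" unfolding Su_ip[OF u(1)] U by simp
  finally have sum_g: "(\<Sum>k<n. (cmod (g k))\<^sup>2) = \<mu> * U" by (simp only: of_real_eq_iff)
  moreover have "0 \<le> (\<Sum>k<n. (cmod (g k))\<^sup>2)" by (simp add: sum_nonneg)
  ultimately show "0 \<le> \<mu>" using U_pos by (simp add: zero_le_mult_iff)
  have row: "\<alpha>\<^sup>2 * (\<mu> * U) + (1 - \<alpha>\<^sup>2) * (cmod (g j))\<^sup>2 \<le>
      (1 - \<alpha>\<^sup>2) * U + \<alpha>\<^sup>2 / b * (\<mu>\<^sup>2 * (cmod (g j))\<^sup>2)" if j: "j < n" for j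
  proof -
    have "(\<Sum>k<n. (cmod (u \<bullet>c v k))\<^sup>2 * (cmod (v k \<bullet>c v j))\<^sup>2) =
        (\<Sum>k<n. \<alpha>\<^sup>2 * (cmod (g k))\<^sup>2 + (if k = j then (1 - \<alpha>\<^sup>2) * (cmod (g j))\<^sup>2 else 0))"
      using j by (intro sum.cong refl) (auto simp: norm_ip g_def algebra_simps)
    also have "\<dots> = \<alpha>\<^sup>2 * (\<mu> * U) + (1 - \<alpha>\<^sup>2) * (cmod (g j))\<^sup>2"
      using j by (simp add: sum.distrib sum_g flip: sum_distrib_left)
    finally show ?thesis
      using rank_one_bound[OF u(1) v[OF j]] U_pos Su_ip[OF v[OF j]] unit[OF j]
      by (simp add: U norm_mult power_mult_distrib flip: g_def)
  qed
  have "(\<Sum>j<n. \<alpha>\<^sup>2 * (\<mu> * U) + (1 - \<alpha>\<^sup>2) * (cmod (g j))\<^sup>2) \<le>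
      (\<Sum>j<n. (1 - \<alpha>\<^sup>2) * U + \<alpha>\<^sup>2 / b * \<mu>\<^sup>2 * (cmod (g j))\<^sup>2)"
    by (rule sum_mono) (use row in \<open>simp add: mult.assoc\<close>)
  then have "\<alpha>\<^sup>2 * (\<mu> * (real n * U)) + (1 - \<alpha>\<^sup>2) * (\<mu> * U) \<le>
      (1 - \<alpha>\<^sup>2) * (real n * U) + \<alpha>\<^sup>2 / b * \<mu>\<^sup>2 * (\<mu> * U)"
    unfolding sum.distrib sum_distrib_left[symmetric] sum_g sum_constant card_lessThan
    by simp
  \<comment> \<open>The coefficients of \<open>\<mu> * U\<close> on the left,
    \<open>\<alpha>^2 * n\<close> and \<open>1 - \<alpha>^2\<close>, add up to
    \<open>b\<close>.\<close>
  then have "b * \<mu> * U \<le> ((1 - \<alpha>\<^sup>2) * real n + \<alpha>\<^sup>2 * \<mu> ^ 3 / b) * U"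
    by (simp add: b_def algebra_simps power3_eq_cube power2_eq_square)
  then show "b * \<mu> \<le> (1 - \<alpha>\<^sup>2) * real n + \<alpha>\<^sup>2 * \<mu> ^ 3 / b"
    using U_pos by simp
qed

text \<open>\<open>\<mu>\<close> is the eigenvalue of largest square. The fourth moment is at most
  \<open>\<mu>^2\<close> times the second moment \<open>n * b\<close>, and \<open>m_bound\<close>
  bounds it from below. The last inequality is Cauchy-Schwarz for the other eigenvalues.\<close>

lemma ex_dominant_eigenvalue:
  assumes n: "n > 0" "real n * \<alpha> ^ 4 \<ge> 1"
  shows "\<exists>\<mu>. 0 \<le> \<mu> \<and> b * \<mu> \<le> (1 - \<alpha>\<^sup>2) * real n + \<alpha>\<^sup>2 * \<mu> ^ 3 / b \<and>
    (real n)\<^sup>2 * (real n * \<alpha> ^ 4 - 1) \<le> \<mu>\<^sup>2 * b \<and> \<mu>\<^sup>2 \<le> real n * b \<and>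
    (real n - \<mu>)\<^sup>2 \<le> real r * (real n * b - \<mu>\<^sup>2)"
proof -
  have "S $$ (a, c) = cnj (S $$ (c, a))" if "a < r" "c < r" for a c
    using that by (simp add: S_def mult.commute)
  from hermitian_spectrum[OF S_carrier this] obtain d :: "nat \<Rightarrow> real" where
    d: "mtrace S = of_real (\<Sum>i<r. d i)" "mtrace (S * S) = of_real (\<Sum>i<r. d i ^ 2)"
       "mtrace (S * S * (S * S)) = of_real (\<Sum>i<r. d i ^ 4)" "\<And>i. i < r \<Longrightarrow> eigenvalue S (of_real (d i))"
    by blast
  have "complex_of_real (\<Sum>i<r. d i) = of_real (real n)" using d(1) mtrace_S(1) by simp
  then have d1: "(\<Sum>i<r. d i) = real n" by (simp only: of_real_eq_iff)
  have d2: "(\<Sum>i<r. d i ^ 2) = real n * b" using d(2) mtrace_S(2) by (simp only: of_real_eq_iff)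
  have d4: "(\<Sum>i<r. d i ^ 4) = (\<Sum>i<n. \<Sum>j<n. (cmod (m i j))\<^sup>2)"
    using d(3) mtrace_S(3) by (simp only: of_real_eq_iff)
  have "r > 0" using d1 n by (cases r) auto
  then have "finite ((\<lambda>i. d i ^ 2) ` {..<r})" "(\<lambda>i. d i ^ 2) ` {..<r} \<noteq> {}" by auto
  from Max_in[OF this] Max_ge[OF this(1)] obtain t where t: "t < r" "\<And>i. i < r \<Longrightarrow> d i ^ 2 \<le> d t ^ 2"
    by fastforce
  have "real n * (real n * (real n * (real n * \<alpha> ^ 4 - 1))) =
      (\<Sum>i<n. \<Sum>j<n. real n * (real n * \<alpha> ^ 4 - 1))" by simp
  also have "\<dots> \<le> (\<Sum>i<n. \<Sum>j<n. (cmod (m i j))\<^sup>2)"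
    by (intro sum_mono m_bound n) auto
  also have "\<dots> = (\<Sum>i<r. d i ^ 2 * d i ^ 2)" unfolding d4[symmetric] by (simp flip: power_add)
  also have "\<dots> \<le> (\<Sum>i<r. d t ^ 2 * d i ^ 2)"
    by (intro sum_mono mult_right_mono t) auto
  also have "\<dots> = real n * ((d t)\<^sup>2 * b)" unfolding sum_distrib_left[symmetric] d2 by simp
  finally have dom: "(real n)\<^sup>2 * (real n * \<alpha> ^ 4 - 1) \<le> (d t)\<^sup>2 * b"
    using n(1) by (simp add: power2_eq_square mult.assoc)
  have split: "(\<Sum>i<r. f i) = f t + (\<Sum>i\<in>{..<r} - {t}. f i)" for f :: "nat \<Rightarrow> real"
    by (rule sum.remove) (use t in auto)
  have rest1: "(\<Sum>i\<in>{..<r} - {t}. d i) = real n - d t" using split[of d] d1 by simp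
  have rest2: "(\<Sum>i\<in>{..<r} - {t}. (d i)\<^sup>2) = real n * b - (d t)\<^sup>2"
    using split[of "\<lambda>i. (d i)\<^sup>2"] d2 by simp
  have nonneg: "0 \<le> real n * b - (d t)\<^sup>2"
    unfolding rest2[symmetric] by (simp add: sum_nonneg)
  have "(real n - d t)\<^sup>2 \<le> real (card ({..<r} - {t})) * (real n * b - (d t)\<^sup>2)"
    using sum_squared_le_card_mult[of "{..<r} - {t}" d] by (simp only: rest1 rest2 finite_Diff finite_lessThan)
  moreover have "real (card ({..<r} - {t})) * (real n * b - (d t)\<^sup>2) \<le> real r * (real n * b - (d t)\<^sup>2)"
    by (intro mult_right_mono nonneg) (use t(1) in simp)
  ultimately have cs: "(real n - d t)\<^sup>2 \<le> real r * (real n * b - (d t)\<^sup>2)"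
    by (rule order_trans)
  have le: "(d t)\<^sup>2 \<le> real n * b" using nonneg by (simp only: diff_ge_0_iff_ge)
  show ?thesis
    by (intro exI[of _ "d t"] conjI S_eigenvalue[OF d(4)[OF t(1)]] dom cs le)
qed

end

section \<open>Asymptotics\<close>

lemma (in equiangular_vectors) dimension_bound:
  fixes c e K :: real
  assumes e: "e > 0" and c: "c > 0" "c\<^sup>2 = e / (2 * (1 + e))" and small: "\<alpha> < c" "2 * \<alpha> < 1"
    and K: "K = sqrt ((1 - \<alpha> / c) / (1 + \<alpha>\<^sup>2))"
    and n: "(1 + e) / \<alpha> ^ 4 \<le> real n"
  shows "(1 + e) * (1 - 2 * \<alpha>)\<^sup>2 * K / \<alpha> ^ 3 \<le> real r"
proof -
  define N where "N = real n"
  have N4: "1 + e \<le> N * \<alpha> ^ 4" using n \<alpha> by (simp add: N_def pos_divide_le_eq)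
  then have N4': "1 \<le> N * \<alpha> ^ 4" using e by simp
  have N0: "N > 0" using N4' by (cases "N = 0") (auto simp: N_def)
  obtain \<mu> where \<mu>: "0 \<le> \<mu>" "b * \<mu> \<le> (1 - \<alpha>\<^sup>2) * N + \<alpha>\<^sup>2 * \<mu> ^ 3 / b"
    "N\<^sup>2 * (N * \<alpha> ^ 4 - 1) \<le> \<mu>\<^sup>2 * b" "\<mu>\<^sup>2 \<le> N * b" "(N - \<mu>)\<^sup>2 \<le> real r * (N * b - \<mu>\<^sup>2)"
    using ex_dominant_eigenvalue N0 N4' unfolding N_def by auto
  have b: "b = 1 - \<alpha>\<^sup>2 + \<alpha>\<^sup>2 * N" by (simp add: b_def N_def)
  have a2: "0 < \<alpha>\<^sup>2" "0 < \<alpha> ^ 4" using \<alpha> by auto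
  have b_lower: "\<alpha>\<^sup>2 * N \<le> b" using \<alpha>_sq by (simp add: b)
  have b_upper: "b \<le> \<alpha>\<^sup>2 * N * (1 + \<alpha>\<^sup>2)"
  proof -
    have "\<alpha>\<^sup>2 * N * (1 + \<alpha>\<^sup>2) = \<alpha>\<^sup>2 * N + N * \<alpha> ^ 4"
      by (simp add: power2_eq_square power4_eq_xxxx algebra_simps)
    then show ?thesis unfolding b using N4' a2 by linarith
  qed
  also have "\<dots> \<le> \<alpha>\<^sup>2 * N * 2" using a2 N0 \<alpha>_sq by (intro mult_left_mono) auto
  finally have b_upper2: "b \<le> 2 * (\<alpha>\<^sup>2 * N)" by simp

  have \<mu>_lower: "c * (N * \<alpha>) \<le> \<mu>"
  proof (rule power2_le_imp_le[OF _ \<mu>(1)])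
    have "N * \<alpha> ^ 4 * (e / (1 + e)) \<le> N * \<alpha> ^ 4 - 1"
      using N4 e by (simp add: field_simps)
    then have "N\<^sup>2 * (N * \<alpha> ^ 4 * (e / (1 + e))) \<le> N\<^sup>2 * (N * \<alpha> ^ 4 - 1)"
      by (intro mult_left_mono) auto
    also have "\<dots> \<le> \<mu>\<^sup>2 * (2 * (\<alpha>\<^sup>2 * N))"
      using \<mu>(3) mult_left_mono[OF b_upper2, of "\<mu>\<^sup>2"] by simp
    also have "N\<^sup>2 * (N * \<alpha> ^ 4 * (e / (1 + e))) = (c * (N * \<alpha>))\<^sup>2 * (2 * (\<alpha>\<^sup>2 * N))"
      unfolding power_mult_distrib c(2) using e by (simp add: field_simps power2_eq_square power4_eq_xxxx)
    finally show "(c * (N * \<alpha>))\<^sup>2 \<le> \<mu>\<^sup>2" using a2 N0 by simp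
  qed
  then have \<mu>_pos: "\<mu> > 0" using c(1) N0 \<alpha> by (smt (verit) mult_pos_pos)
  \<comment> \<open>The cubic inequality, read as a bound on the sum of squares of the remaining
    eigenvalues.\<close>
  have gap: "\<alpha>\<^sup>2 * \<mu> * (N * b - \<mu>\<^sup>2) \<le> N * b"
  proof -
    have "\<alpha>\<^sup>2 * \<mu> * (N * b - \<mu>\<^sup>2) = b * (\<alpha>\<^sup>2 * N * \<mu>) - \<alpha>\<^sup>2 * \<mu> ^ 3"
      by (simp add: algebra_simps power2_eq_square power3_eq_cube)
    also have "\<dots> \<le> b * (b * \<mu>) - \<alpha>\<^sup>2 * \<mu> ^ 3"
      using b_lower b_pos \<mu>(1) by (intro diff_right_mono mult_left_mono mult_right_mono) auto
    also have "\<dots> \<le> b * ((1 - \<alpha>\<^sup>2) * N + \<alpha>\<^sup>2 * \<mu> ^ 3 / b) - \<alpha>\<^sup>2 * \<mu> ^ 3"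
      using \<mu>(2) b_pos by (intro diff_right_mono mult_left_mono) auto
    also have "\<dots> = b * ((1 - \<alpha>\<^sup>2) * N)" using b_pos by (simp add: algebra_simps)
    also have "\<dots> \<le> b * (1 * N)"
      using a2 b_pos N0 by (intro mult_left_mono mult_right_mono) auto
    finally show ?thesis by (simp add: mult.commute)
  qed

  have \<mu>_upper: "\<mu> \<le> 2 * \<alpha> * N"
  proof (rule power2_le_imp_le)
    have "\<mu>\<^sup>2 \<le> N * (2 * (\<alpha>\<^sup>2 * N))" using order_trans[OF \<mu>(4) mult_left_mono[OF b_upper2, of N]] N0 by simp
    also have "\<dots> \<le> (2 * \<alpha> * N)\<^sup>2" using a2 N0 by (simp add: power2_eq_square)
    finally show "\<mu>\<^sup>2 \<le> (2 * \<alpha> * N)\<^sup>2" .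
  qed (use \<alpha> N0 in simp)
  \<comment> \<open>Bootstrapping: the crude bound inserted into \<open>gap\<close> gives
    \<open>N * b - \<mu>^2 \<le> (\<alpha> / c) * N * b\<close>, so \<open>\<mu>^2\<close> is nearly
    \<open>N * b\<close>; the sharp \<open>b_upper\<close> converts this to a multiple of
    \<open>b^2\<close>.\<close>
  have \<mu>_large: "K * b \<le> \<alpha> * \<mu>"
  proof (rule power2_le_imp_le)
    have "c \<le> \<alpha> ^ 3 * N * c * \<alpha>"
      using mult_left_mono[OF N4', of c] c(1) by (simp add: power4_eq_xxxx power3_eq_cube mult_ac)
    also have "\<dots> = \<alpha> * (\<alpha>\<^sup>2 * (c * (N * \<alpha>)))" by (simp add: power2_eq_square power3_eq_cube mult_ac)
    also have "\<dots> \<le> \<alpha> * (\<alpha>\<^sup>2 * \<mu>)" using \<mu>_lower \<alpha> by (intro mult_left_mono) auto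
    finally have "c * (N * b - \<mu>\<^sup>2) \<le> \<alpha> * (\<alpha>\<^sup>2 * \<mu>) * (N * b - \<mu>\<^sup>2)"
      using \<mu>(4) by (intro mult_right_mono) auto
    also have "\<dots> \<le> \<alpha> * (N * b)" using gap \<alpha> by (simp add: mult.assoc mult_left_mono)
    finally have "(1 - \<alpha> / c) * (N * b) \<le> \<mu>\<^sup>2" using c(1) by (simp add: field_simps)
    then have \<mu>_sq: "\<alpha>\<^sup>2 * ((1 - \<alpha> / c) * (N * b)) \<le> \<alpha>\<^sup>2 * \<mu>\<^sup>2"
      by (intro mult_left_mono) auto
    have c1: "0 \<le> 1 - \<alpha> / c" using small c(1) by simp
    have pos: "0 < 1 + \<alpha>\<^sup>2" using a2 by linarith
    have "(K * b)\<^sup>2 = (1 - \<alpha> / c) * b / (1 + \<alpha>\<^sup>2) * b"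
      using c1 pos by (simp add: K power_mult_distrib) (simp add: power2_eq_square)
    also have "\<dots> \<le> (1 - \<alpha> / c) * b / (1 + \<alpha>\<^sup>2) * (\<alpha>\<^sup>2 * N * (1 + \<alpha>\<^sup>2))"
      using b_upper c1 pos b_pos by (intro mult_left_mono) auto
    also have "\<dots> = \<alpha>\<^sup>2 * ((1 - \<alpha> / c) * (N * b))" using pos by simp
    also note \<mu>_sq
    finally show "(K * b)\<^sup>2 \<le> (\<alpha> * \<mu>)\<^sup>2" by (simp add: power_mult_distrib)
  qed (use \<alpha> \<mu>(1) in simp)

  have K0: "K \<ge> 0" using small c(1) by (simp add: K)
  have sq: "(N * (1 - 2 * \<alpha>))\<^sup>2 \<le> (N - \<mu>)\<^sup>2"
    using \<mu>_upper small N0 by (intro power_mono) (auto simp: algebra_simps)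
  \<comment> \<open>The Cauchy-Schwarz inequality is multiplied by
    \<open>\<alpha>^2 * \<mu>\<close>, so that \<open>gap\<close> applies on the right and
    \<open>N * b\<close> cancels.\<close>
  have "\<alpha> * (K * b) \<le> \<alpha> * (\<alpha> * \<mu>)"
    using \<mu>_large \<alpha> by (intro mult_left_mono) auto
  then have "\<alpha> * (K * b) * (N * (1 - 2 * \<alpha>))\<^sup>2 \<le> \<alpha> * (\<alpha> * \<mu>) * (N - \<mu>)\<^sup>2"
    by (rule mult_mono[OF _ sq]) (use \<alpha> \<mu>(1) in auto)
  also have "\<dots> \<le> \<alpha> * (\<alpha> * \<mu>) * (real r * (N * b - \<mu>\<^sup>2))"
    using \<mu>(1,5) \<alpha> by (intro mult_left_mono) auto
  also have "\<dots> = real r * (\<alpha>\<^sup>2 * \<mu> * (N * b - \<mu>\<^sup>2))" by (simp add: power2_eq_square)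
  also have "\<dots> \<le> real r * (N * b)" using gap by (intro mult_left_mono) auto
  finally have "(\<alpha> * K * N * (1 - 2 * \<alpha>)\<^sup>2) * (N * b) \<le> real r * (N * b)"
    by (simp add: power_mult_distrib power2_eq_square[of N] mult_ac)
  then have "\<alpha> * K * N * (1 - 2 * \<alpha>)\<^sup>2 \<le> real r"
    by (rule mult_right_le_imp_le) (use N0 b_pos in simp)
  moreover have "(1 + e) * (1 - 2 * \<alpha>)\<^sup>2 * K / \<alpha> ^ 3 \<le> \<alpha> * K * N * (1 - 2 * \<alpha>)\<^sup>2"
  proof -
    have "(1 + e) * ((1 - 2 * \<alpha>)\<^sup>2 * K) \<le> N * \<alpha> ^ 4 * ((1 - 2 * \<alpha>)\<^sup>2 * K)"
      using N4 K0 by (intro mult_right_mono) auto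
    then show ?thesis using \<alpha> by (simp add: pos_divide_le_eq power4_eq_xxxx power3_eq_cube mult_ac)
  qed
  ultimately show ?thesis by simp
qed

lemma complex_equiangular_vectors:
  assumes "complex_equiangular r \<alpha> n l" "0 < \<alpha>" "\<alpha> < 1"
  shows "\<exists>v. equiangular_vectors v n r \<alpha>"
proof -
  from assms obtain v where v: "\<forall>i<n. complex_line r (l i)" "\<forall>i<n. v i \<in> l i \<and> v i \<bullet>c v i = 1"
    "\<forall>i<n. \<forall>j<n. i \<noteq> j \<longrightarrow> cmod (v i \<bullet>c v j) = \<alpha>"
    unfolding complex_equiangular_def by blast
  have "v i \<in> carrier_vec r" if "i < n" for i
  proof -
    have "VectorSpace.subspace class_ring (l i) (module_vec TYPE(complex) r)"
      using v(1) that by (simp add: complex_line_def)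
    then have "l i \<subseteq> carrier (module_vec TYPE(complex) r)"
      by (simp add: VectorSpace.subspace_def submodule_def)
    then show ?thesis using v(2) that by (auto simp: module_vec_simps)
  qed
  then have "equiangular_vectors v n r \<alpha>"
    by unfold_locales (use v assms in auto)
  then show ?thesis by blast
qed

text \<open>If the claim fails, \<open>dimension_bound\<close> forces \<open>r\<close> above
  \<open>1 / \<alpha>^3\<close> once its prefactor exceeds 1. That threshold depends on
  \<open>e\<close> alone, so the bound is uniform in \<open>r\<close>, \<open>n\<close> and
  \<open>l\<close>.\<close>

lemma eventually_equiangular_upper_bound:
  assumes e: "e > (0::real)"
  shows "\<forall>\<^sub>F \<alpha> in at_right 0. \<forall>r n l. complex_equiangular r \<alpha> n l \<longrightarrow> real r < 1 / \<alpha> ^ 3 \<longrightarrow>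
    \<alpha> ^ 4 * real n < 1 + e"
proof -
  define c where "c = sqrt (e / (2 * (1 + e)))"
  have c: "c > 0" "c\<^sup>2 = e / (2 * (1 + e))" using e by (auto simp: c_def)
  define K where "K \<alpha> = sqrt ((1 - \<alpha> / c) / (1 + \<alpha>\<^sup>2))" for \<alpha> :: real
  have "((\<lambda>\<alpha>. (1 + e) * (1 - 2 * \<alpha>)\<^sup>2 * K \<alpha>) \<longlongrightarrow>
      (1 + e) * (1 - 2 * 0)\<^sup>2 * sqrt ((1 - 0 / c) / (1 + 0\<^sup>2))) (at_right 0)"
    unfolding K_def using c by (intro tendsto_intros) auto
  then have "\<forall>\<^sub>F \<alpha> in at_right 0. 1 < (1 + e) * (1 - 2 * \<alpha>)\<^sup>2 * K \<alpha>"
    by (rule order_tendstoD(1)) (use e in simp)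
  moreover have "\<forall>\<^sub>F \<alpha> in at_right (0::real). 0 < \<alpha> \<and> \<alpha> < min c (1 / 2)"
    using eventually_at_right_real[of 0 "min c (1 / 2)"] c(1) by (simp add: greaterThanLessThan_iff)
  ultimately show ?thesis
  proof eventually_elim
    case (elim \<alpha>)
    show ?case
    proof (intro allI impI)
      fix r n l
      assume l: "complex_equiangular r \<alpha> n l" and r: "real r < 1 / \<alpha> ^ 3"
      obtain v where "equiangular_vectors v n r \<alpha>"
        using complex_equiangular_vectors[OF l] elim by auto
      then interpret equiangular_vectors v n r \<alpha> .
      show "\<alpha> ^ 4 * real n < 1 + e"
      proof (rule ccontr)
        assume "\<not> \<alpha> ^ 4 * real n < 1 + e"
        then have "(1 + e) / \<alpha> ^ 4 \<le> real n" using elim by (simp add: pos_divide_le_eq mult.commute)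
        from dimension_bound[OF e c _ _ K_def this] elim
        have "(1 + e) * (1 - 2 * \<alpha>)\<^sup>2 * K \<alpha> / \<alpha> ^ 3 \<le> real r" by simp
        moreover have "1 / \<alpha> ^ 3 < (1 + e) * (1 - 2 * \<alpha>)\<^sup>2 * K \<alpha> / \<alpha> ^ 3"
          using elim by (intro divide_strict_right_mono) auto
        ultimately show False using r by simp
      qed
    qed
  qed
qed

text \<open>\<open>x = q + 1\<close> is the larger root of
  \<open>\<alpha>^2 x^2 - x + 1 = 0\<close>. With \<open>t = 1 / x\<close> one has
  \<open>\<alpha>^2 = t - t^2\<close>, and the count becomes
  \<open>(1 - t)^2 (1 - t + t^2) \<ge> 1 - 3 t\<close>; the constant 6 comes from
  \<open>t \<le> 2 \<alpha>^2\<close>.\<close>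

lemma singer_angle:
  fixes \<alpha> :: real and q :: nat
  assumes \<alpha>: "0 < \<alpha>" "2 * \<alpha> < 1" and q: "(1 + sqrt (1 - 4 * \<alpha>\<^sup>2)) / (2 * \<alpha>\<^sup>2) = real q + 1"
  shows "\<alpha> = sqrt (real q) / (real q + 1)" "1 - 6 * \<alpha>\<^sup>2 \<le> \<alpha> ^ 4 * real (q\<^sup>2 + q + 1)"
proof -
  define s where "s = sqrt (1 - 4 * \<alpha>\<^sup>2)"
  define x where "x = real q + 1"
  have "(2 * \<alpha>)\<^sup>2 \<le> 1" using \<alpha> by (intro power_le_one) auto
  then have s: "s\<^sup>2 = 1 - 4 * \<alpha>\<^sup>2" "s \<ge> 0" by (auto simp: s_def power_mult_distrib)
  have x0: "x > 0" by (simp add: x_def)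
  have ax: "2 * \<alpha>\<^sup>2 * x = 1 + s" using q \<alpha> by (simp add: x_def s_def field_simps)
  then have "(2 * \<alpha>\<^sup>2 * x - 1)\<^sup>2 = 1 - 4 * \<alpha>\<^sup>2" using s(1) by simp
  then have "4 * \<alpha>\<^sup>2 * (\<alpha>\<^sup>2 * x\<^sup>2 - x + 1) = 0" by (simp add: power2_eq_square algebra_simps)
  then have root: "\<alpha>\<^sup>2 * x\<^sup>2 = x - 1" using \<alpha> by auto
  then have "(\<alpha> * x)\<^sup>2 = real q" by (simp add: power_mult_distrib x_def)
  then have "\<alpha> * x = sqrt (real q)" using \<alpha> x0 by (intro real_sqrt_unique[symmetric]) auto
  then show "\<alpha> = sqrt (real q) / (real q + 1)" by (simp add: x_def[symmetric] nonzero_eq_divide_eq x0[THEN less_imp_neq, symmetric])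
  define t where "t = 1 / x"
  have t: "0 \<le> t" "t \<le> 1" by (auto simp: t_def x_def)
  have "t \<le> 2 * \<alpha>\<^sup>2" using ax s(2) x0 by (simp add: t_def pos_divide_le_eq)
  have a2: "\<alpha>\<^sup>2 = t - t\<^sup>2" using root x0 by (simp add: t_def field_simps power2_eq_square)
  have N: "t\<^sup>2 * real (q\<^sup>2 + q + 1) = 1 - t + t\<^sup>2"
  proof -
    have "real (q\<^sup>2 + q + 1) = x\<^sup>2 - x + 1"
      by (simp add: x_def power2_eq_square algebra_simps)
    then show ?thesis using x0 by (simp only:) (simp add: t_def field_simps power2_eq_square)
  qed
  have "\<alpha> ^ 4 * real (q\<^sup>2 + q + 1) = (1 - t)\<^sup>2 * (t\<^sup>2 * real (q\<^sup>2 + q + 1))"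
  proof -
    have "\<alpha> ^ 4 = (\<alpha>\<^sup>2)\<^sup>2" by simp
    also have "\<dots> = (1 - t)\<^sup>2 * t\<^sup>2" unfolding a2 by (simp add: power2_eq_square algebra_simps)
    finally show ?thesis by (simp only: mult.assoc)
  qed
  also have "\<dots> = 1 - 3 * t + t\<^sup>2 * (4 - 3 * t + t\<^sup>2)"
    unfolding N by (simp add: power2_eq_square algebra_simps)
  also have "\<dots> \<ge> 1 - 3 * t" using t by simp
  finally show "1 - 6 * \<alpha>\<^sup>2 \<le> \<alpha> ^ 4 * real (q\<^sup>2 + q + 1)" using \<open>t \<le> 2 * \<alpha>\<^sup>2\<close> by linarith
qed

lemma eventually_max_complex_equiangular:
  assumes e: "e > (0::real)"
  shows "\<forall>\<^sub>F \<alpha> in at_right 0. \<forall>q r. primepow q \<longrightarrow> (1 + sqrt (1 - 4 * \<alpha>\<^sup>2)) / (2 * \<alpha>\<^sup>2) = real q + 1 \<longrightarrow>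
    real q + 1 \<le> real r \<longrightarrow> real r < 1 / \<alpha> ^ 3 \<longrightarrow>
    \<bar>\<alpha> ^ 4 * real (max_complex_equiangular \<alpha> r) - 1\<bar> \<le> e"
proof -
  have "\<forall>\<^sub>F \<alpha> in at_right (0::real). 0 < \<alpha> \<and> \<alpha> < min (1 / 2) (sqrt (e / 6))"
    using eventually_at_right_real[of 0 "min (1 / 2) (sqrt (e / 6))"] e by (simp add: greaterThanLessThan_iff)
  with eventually_equiangular_upper_bound[OF e] show ?thesis
  proof eventually_elim
    case (elim \<alpha>)
    show ?case
    proof (intro allI impI)
      fix q r :: nat
      assume q: "primepow q" "(1 + sqrt (1 - 4 * \<alpha>\<^sup>2)) / (2 * \<alpha>\<^sup>2) = real q + 1"
        and r: "real q + 1 \<le> real r" "real r < 1 / \<alpha> ^ 3"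
      define L where "L = {n. \<exists>l. complex_equiangular r \<alpha> n l}"
      have upper: "\<alpha> ^ 4 * real n < 1 + e" if "n \<in> L" for n
        using elim(1) that r(2) unfolding L_def by blast
      \<comment> \<open>Finiteness makes \<open>Max\<close> a genuine maximum; here it comes from
        the upper bound itself.\<close>
      have fin: "finite L"
      proof (rule finite_subset)
        show "L \<subseteq> {..nat \<lceil>(1 + e) / \<alpha> ^ 4\<rceil>}"
        proof
          fix n assume "n \<in> L"
          from upper[OF this] elim have "real n \<le> (1 + e) / \<alpha> ^ 4"
            by (simp add: pos_le_divide_eq mult.commute)
          then show "n \<in> {..nat \<lceil>(1 + e) / \<alpha> ^ 4\<rceil>}" by (simp add: le_nat_iff le_ceiling_iff)
        qed
      qed simp
      have singer: "q\<^sup>2 + q + 1 \<in> L"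
        using ex_equiangular_singer[OF q(1), of r] r(1) singer_angle(1)[of \<alpha> q] elim q(2)
        unfolding L_def by auto
      have max: "max_complex_equiangular \<alpha> r = Max L" by (simp add: max_complex_equiangular_def L_def)
      have "\<alpha> ^ 4 * real (Max L) < 1 + e" using upper Max_in[OF fin] singer by blast
      moreover have "1 - 6 * \<alpha>\<^sup>2 \<le> \<alpha> ^ 4 * real (Max L)"
      proof -
        have "real (q\<^sup>2 + q + 1) \<le> real (Max L)" using Max_ge[OF fin singer] by (simp only: of_nat_le_iff)
        then have "\<alpha> ^ 4 * real (q\<^sup>2 + q + 1) \<le> \<alpha> ^ 4 * real (Max L)" by (intro mult_left_mono) auto
        moreover have "1 - 6 * \<alpha>\<^sup>2 \<le> \<alpha> ^ 4 * real (q\<^sup>2 + q + 1)"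
          by (rule singer_angle(2)[OF _ _ q(2)]) (use elim in auto)
        ultimately show ?thesis by (rule order_trans[rotated])
      qed
      moreover have "\<alpha>\<^sup>2 \<le> e / 6"
      proof -
        have "\<alpha>\<^sup>2 \<le> (sqrt (e / 6))\<^sup>2" using elim by (intro power_mono) auto
        then show ?thesis using e by simp
      qed
      ultimately show "\<bar>\<alpha> ^ 4 * real (max_complex_equiangular \<alpha> r) - 1\<bar> \<le> e"
        unfolding max by linarith
    qed
  qed
qed

theorem corollary1p14:
  shows "\<exists>\<delta> \<epsilon> :: real \<Rightarrow> real.
    (\<delta> \<longlongrightarrow> 0) (at_right 0) \<and> (\<epsilon> \<longlongrightarrow> 0) (at_right 0) \<and>
    (\<forall>\<alpha>::real. 0 < \<alpha> \<longrightarrow> \<alpha> < 1 \<longrightarrow>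
       (\<exists>q::nat. primepow q \<and> (1 + sqrt (1 - 4 * \<alpha>^2)) / (2 * \<alpha>^2) - 1 = real q) \<longrightarrow>
       (\<forall>r::nat. 0 < r \<longrightarrow>
          (1 + sqrt (1 - 4 * \<alpha>^2)) / (2 * \<alpha>^2) \<le> real r \<longrightarrow>
          real r < (1 - \<delta> \<alpha>) / \<alpha>^3 \<longrightarrow>
          \<bar>\<alpha>^4 * real (max_complex_equiangular \<alpha> r) - 1\<bar> \<le> \<epsilon> \<alpha>))"
proof -
  define D where "D \<alpha> = (1 + sqrt (1 - 4 * \<alpha>\<^sup>2)) / (2 * \<alpha>\<^sup>2)" for \<alpha> :: real
  define f where "f \<alpha> r = \<bar>\<alpha> ^ 4 * real (max_complex_equiangular \<alpha> r) - 1\<bar>" for \<alpha> r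
  define R where "R \<alpha> = {r. (\<exists>q. primepow q \<and> D \<alpha> = real q + 1) \<and> D \<alpha> \<le> real r \<and> real r < 1 / \<alpha> ^ 3}" for \<alpha>
  \<comment> \<open>The worst error over the finitely many admissible \<open>r\<close>; the inserted
    0 covers the \<open>\<alpha>\<close> for which there are none.\<close>
  define \<epsilon> where "\<epsilon> \<alpha> = Max (insert 0 (f \<alpha> ` R \<alpha>))" for \<alpha>
  have fin: "finite (R \<alpha>)" for \<alpha>
  proof (rule finite_subset)
    show "R \<alpha> \<subseteq> {..nat \<lceil>1 / \<alpha> ^ 3\<rceil>}"
    proof
      fix r assume "r \<in> R \<alpha>"
      then have "real r < 1 / \<alpha> ^ 3" by (simp add: R_def)
      then show "r \<in> {..nat \<lceil>1 / \<alpha> ^ 3\<rceil>}" by simp linarith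
    qed
  qed simp
  have \<epsilon>_upper: "f \<alpha> r \<le> \<epsilon> \<alpha>" if "r \<in> R \<alpha>" for \<alpha> r
    unfolding \<epsilon>_def using that fin by (intro Max_ge) auto
  have \<epsilon>_nonneg: "0 \<le> \<epsilon> \<alpha>" for \<alpha>
    unfolding \<epsilon>_def using fin by (intro Max_ge) auto
  have "(\<epsilon> \<longlongrightarrow> 0) (at_right 0)"
  proof (rule tendstoI)
    fix e :: real assume e: "e > 0"
    \<comment> \<open>Halving turns the weak bound into the strict one of the limit.\<close>
    then have "e / 2 > 0" by simp
    from eventually_max_complex_equiangular[OF this]
    show "\<forall>\<^sub>F \<alpha> in at_right 0. dist (\<epsilon> \<alpha>) 0 < e"
    proof eventually_elim
      case (elim \<alpha>)
      have "f \<alpha> r \<le> e / 2" if "r \<in> R \<alpha>" for r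
        using that elim unfolding R_def D_def f_def by auto
      then have "\<epsilon> \<alpha> \<le> e / 2" unfolding \<epsilon>_def using fin e by (subst Max_le_iff) auto
      then show ?case using \<epsilon>_nonneg[of \<alpha>] e by (simp add: dist_real_def)
    qed
  qed
  \<comment> \<open>\<open>\<delta>\<close> is identically 0: the estimate holds on the whole range
    \<open>r < 1 / \<alpha>^3\<close>.\<close>
  show ?thesis
  proof (rule exI[of _ "\<lambda>_. 0"], rule exI[of _ \<epsilon>], intro conjI allI impI)
    show "(\<epsilon> \<longlongrightarrow> 0) (at_right 0)" by fact
    fix \<alpha> :: real and r :: nat
    assume "\<exists>q. primepow q \<and> (1 + sqrt (1 - 4 * \<alpha>\<^sup>2)) / (2 * \<alpha>\<^sup>2) - 1 = real q"
      and r: "(1 + sqrt (1 - 4 * \<alpha>\<^sup>2)) / (2 * \<alpha>\<^sup>2) \<le> real r" "real r < (1 - 0) / \<alpha> ^ 3"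
    then obtain q where q: "primepow q" "D \<alpha> - 1 = real q" unfolding D_def by blast
    from q(2) have "D \<alpha> = real q + 1" by simp
    then have "r \<in> R \<alpha>"
      unfolding R_def using q(1) r[folded D_def] by (intro CollectI conjI exI[of _ q]) simp_all
    then show "\<bar>\<alpha> ^ 4 * real (max_complex_equiangular \<alpha> r) - 1\<bar> \<le> \<epsilon> \<alpha>"
      using \<epsilon>_upper by (simp add: f_def)
  qed simp
qed

end
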